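(* Let $n\ge 6$ and let $\Pi_n\subseteq\mathbb{R}^n$ be the permutahedron. Then there is no symmetric extended formulation of $\Pi_n$ (symmetric with respect to the group $G=S_n$ acting on the vertex set of $\Pi_n$ by permuting coordinates) with fewer than $\frac{n(n-1)}{4}$ variables and constraints, i.e. for every such formulation the number of its variables plus the number of its constraints is at least $\frac{n(n-1)}{4}$.
   Context: The permutahedron $\Pi_n$ is the convex hull of all points of $\mathbb{R}^n$ obtained from $(1,2,\dots,n)$ by permuting coordinates; its vertex set is $X=\{(\zeta^{-1}(1),\dots,\zeta^{-1}(n)) : \zeta\in S_n\}$. The group $S_n$ acts on $\mathbb{R}^n$ (and on $X$) by $(\pi.x)_v=x_{\pi^{-1}(v)}$; similarly $S_d$ acts on $\mathbb{R}^d$ by permuting coordinates. An extension of a polytope $P\subseteq\mathbb{R}^m$ is a polyhedron $Q\subseteq\mathbb{R}^d$ together with a linear map $p:\mathbb{R}^d\to\mathbb{R}^m$ with $p(Q)=P$; an extended formulation of $P$ is a finite system $A^{=}y=b^{=}$, $A^{\le}y\le b^{\le}$ whose solution set $Q$ is an extension of $P$ (with some linear map $p$). Such an extended formulation is symmetric with respect to a group $G\subseteq S_m$ acting on the vertex set $X$ of $P$ if for every $\pi\in G$ there are a permutation $\varkappa_\pi\in S_d$ with $p(\varkappa_\pi.y)=\pi.p(y)$ for all $y\in p^{-1}(X)$, and permutations $\varrho^{=}_\pi,\varrho^{\le}_\pi$ of the rows of $(A^{=},b^{=})$ and $(A^{\le},b^{\le})$ respectively, such that simultaneously permuting the columns (of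 $A^{=}$, $A^{\le}$) by $\varkappa_\pi$ and the rows by $\varrho^{=}_\pi$, $\varrho^{\le}_\pi$ leaves $(A^{=},b^{=})$ and $(A^{\le},b^{\le})$ unchanged. *)

theory Defs
  imports Complex_Main "HOL-Combinatorics.Permutations"
begin

text \<open>Vectors of R^m are represented as functions nat => real vanishing outside
  the index set {0..<m} (coordinate v of the paper is index v-1 here).\<close>

definition rvec :: "nat \<Rightarrow> (nat \<Rightarrow> real) set" where
  "rvec m = {x. \<forall>i\<ge>m. x i = 0}"

definition perm_act :: "(nat \<Rightarrow> nat) \<Rightarrow> (nat \<Rightarrow> real) \<Rightarrow> (nat \<Rightarrow> real)" where
  "perm_act \<pi> x = (\<lambda>v. x (inv \<pi> v))"

text \<open>Vertex set X of the permutahedron: the points (zeta^-1(1),...,zeta^-1(n)),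
  with indices shifted to {0..<n} and values in {1..n}.\<close>
definition permutahedron_vertices :: "nat \<Rightarrow> (nat \<Rightarrow> real) set" where
  "permutahedron_vertices n =
     {(\<lambda>v. if v < n then real (inv \<zeta> v) + 1 else 0) | \<zeta>. \<zeta> permutes {..<n}}"

definition conv_hull_fin :: "(nat \<Rightarrow> real) set \<Rightarrow> (nat \<Rightarrow> real) set" where
  "conv_hull_fin S = {x. \<exists>c. (\<forall>v\<in>S. c v \<ge> 0) \<and> sum c S = 1 \<and>
                          (\<forall>i. x i = (\<Sum>v\<in>S. c v * v i))}"

definition permutahedron :: "nat \<Rightarrow> (nat \<Rightarrow> real) set" where
  "permutahedron n = conv_hull_fin (permutahedron_vertices n)"

definition lin_map :: "(nat \<Rightarrow> nat \<Rightarrow> real) \<Rightarrow> nat \<Rightarrow> nat \<Rightarrow> (nat \<Rightarrow> real) \<Rightarrow> (nat \<Rightarrow> real)" where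
  "lin_map P m d y = (\<lambda>i. if i < m then (\<Sum>j<d. P i j * y j) else 0)"

definition ef_solutions ::
  "nat \<Rightarrow> nat \<Rightarrow> (nat \<Rightarrow> nat \<Rightarrow> real) \<Rightarrow> (nat \<Rightarrow> real) \<Rightarrow>
   nat \<Rightarrow> (nat \<Rightarrow> nat \<Rightarrow> real) \<Rightarrow> (nat \<Rightarrow> real) \<Rightarrow> (nat \<Rightarrow> real) set" where
  "ef_solutions d k1 A1 b1 k2 A2 b2 =
     {y \<in> rvec d. (\<forall>i<k1. (\<Sum>j<d. A1 i j * y j) = b1 i) \<and>
                  (\<forall>i<k2. (\<Sum>j<d. A2 i j * y j) \<le> b2 i)}"

definition is_ext_form_perm ::
  "nat \<Rightarrow> nat \<Rightarrow> (nat \<Rightarrow> nat \<Rightarrow> real) \<Rightarrow> nat \<Rightarrow> (nat \<Rightarrow> nat \<Rightarrow> real) \<Rightarrow> (nat \<Rightarrow> real) \<Rightarrow>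
   nat \<Rightarrow> (nat \<Rightarrow> nat \<Rightarrow> real) \<Rightarrow> (nat \<Rightarrow> real) \<Rightarrow> bool" where
  "is_ext_form_perm n d P k1 A1 b1 k2 A2 b2 \<longleftrightarrow>
     lin_map P n d ` ef_solutions d k1 A1 b1 k2 A2 b2 = permutahedron n"

definition symmetric_ext_form_perm ::
  "nat \<Rightarrow> nat \<Rightarrow> (nat \<Rightarrow> nat \<Rightarrow> real) \<Rightarrow> nat \<Rightarrow> (nat \<Rightarrow> nat \<Rightarrow> real) \<Rightarrow> (nat \<Rightarrow> real) \<Rightarrow>
   nat \<Rightarrow> (nat \<Rightarrow> nat \<Rightarrow> real) \<Rightarrow> (nat \<Rightarrow> real) \<Rightarrow> bool" where
  "symmetric_ext_form_perm n d P k1 A1 b1 k2 A2 b2 \<longleftrightarrow>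
     (\<forall>\<pi>. \<pi> permutes {..<n} \<longrightarrow>
        (\<exists>\<kappa> \<rho>1 \<rho>2. \<kappa> permutes {..<d} \<and> \<rho>1 permutes {..<k1} \<and> \<rho>2 permutes {..<k2} \<and>
           (\<forall>y\<in>rvec d. lin_map P n d y \<in> permutahedron_vertices n \<longrightarrow>
               lin_map P n d (perm_act \<kappa> y) = perm_act \<pi> (lin_map P n d y)) \<and>
           (\<forall>i<k1. \<forall>j<d. A1 (\<rho>1 i) (\<kappa> j) = A1 i j) \<and> (\<forall>i<k1. b1 (\<rho>1 i) = b1 i) \<and>
           (\<forall>i<k2. \<forall>j<d. A2 (\<rho>2 i) (\<kappa> j) = A2 i j) \<and> (\<forall>i<k2. b2 (\<rho>2 i) = b2 i)))"

end

theory Submission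
  imports Defs
begin

text \<open>
  Averaging over all lifts of a permutation gives an equivariant section of the projection, so the
  slacks of the inequalities become a family of nonnegative functions on the symmetric group that
  is closed under translation. Each facet \<open>x\<^sub>1 + \<dots> + x\<^sub>k \<ge> 1 + \<dots> + k\<close> forces a member of this family that
  vanishes on the facet but not on the adjacent layer of vertices.

  For such a member \<open>t\<close>, consider the function that sums \<open>t\<close> over all \<open>\<sigma>\<close> with \<open>\<sigma>(I) = {1..k}\<close>, for
  \<open>k\<close>-sets \<open>I\<close>. If it had a nonzero second difference, its translates would span a space at least as
  large as a Specht module of shape \<open>(n - i, i)\<close> with \<open>2 \<le> i < n/2\<close>, whose dimension is at least
  \<open>n(n - 3)/2\<close>; the condition \<open>2k \<noteq> n\<close> excludes \<open>i = n/2\<close>. So in a small family it is affine in the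
  indicator of \<open>I\<close>, and counting translates again shows that it only depends on whether \<open>I\<close>
  contains one particular point \<open>v\<close>. Then \<open>t\<close> vanishes unless \<open>\<sigma>(v) > k\<close>, or unless \<open>\<sigma>(v) \<le> k\<close>, with
  \<open>k\<close> optimal. Every member has at most one pair \<open>(k, v)\<close> of either kind, while all of the at least
  \<open>(n - 2) n\<close> pairs must occur, so the family has at least \<open>n(n - 2)/2\<close> members.
\<close>

subsection \<open>Permutations\<close>

text \<open>A permutation that is right on the tails is corrected at the head by composing it with
  the transposition of \<open>\<pi> x\<close> and \<open>y\<close>, neither of which lies in
  \<open>ys\<close>.\<close>

lemma ex_permutes_map_eq:
  assumes "distinct xs" "distinct ys" "length xs = length ys"
    and "set xs \<subseteq> A" "set ys \<subseteq> A"
  shows "\<exists>\<pi>. \<pi> permutes A \<and> map \<pi> xs = ys"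
  using assms(3,1,2,4,5)
proof (induction xs ys rule: list_induct2)
  case Nil
  show ?case by (auto intro: permutes_id)
next
  case (Cons x xs y ys)
  then obtain \<pi> where \<pi>: "\<pi> permutes A" "map \<pi> xs = ys" by auto
  have "\<pi> x \<in> A" using \<pi>(1) Cons.prems by (simp add: permutes_in_image)
  have "\<pi> x \<notin> set ys"
    using \<pi>(2) Cons.prems inj_eq[OF permutes_inj[OF \<pi>(1)]] by auto
  have "transpose (\<pi> x) y \<circ> \<pi> permutes A"
    using \<pi>(1) \<open>\<pi> x \<in> A\<close> Cons.prems by (intro permutes_compose permutes_swap_id) auto
  moreover have "map (transpose (\<pi> x) y) ys = ys"
    using \<open>\<pi> x \<notin> set ys\<close> Cons.prems by (intro map_idI) (auto simp: transpose_def)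
  then have "map (transpose (\<pi> x) y \<circ> \<pi>) (x # xs) = y # ys"
    using \<pi>(2) by (metis list.map_comp list.simps(9) o_apply transpose_apply_first)
  ultimately show ?case by (intro exI[of _ "transpose (\<pi> x) y \<circ> \<pi>"] conjI)
qed

lemma ex_permutes_image_eq:
  assumes "finite A" "B \<subseteq> A" "C \<subseteq> A" "card B = card C"
  shows "\<exists>\<pi>. \<pi> permutes A \<and> \<pi> ` B = C"
proof -
  obtain xs where xs: "set xs = B" "distinct xs"
    using assms finite_distinct_list finite_subset by metis
  obtain ys where ys: "set ys = C" "distinct ys"
    using assms finite_distinct_list finite_subset by metis
  have "length xs = length ys"
    using xs ys assms(4) distinct_card by metis
  then obtain \<pi> where "\<pi> permutes A" "map \<pi> xs = ys"
    using ex_permutes_map_eq[of xs ys A] xs ys assms by auto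
  then show ?thesis using xs ys by (metis list.set_map)
qed

subsection \<open>Linear systems\<close>

text \<open>Gaussian elimination over the equations \<open>J\<close>: either equation
  \<open>j\<close> is trivial on \<open>M\<close>, or it has a pivot unknown \<open>p\<close>, which
  is eliminated from the other equations.\<close>

lemma underdetermined_system:
  fixes L :: "'i \<Rightarrow> 'j \<Rightarrow> real"
  assumes "finite J" "finite M" "card J < card M"
  shows "\<exists>c. (\<exists>i\<in>M. c i \<noteq> 0) \<and> (\<forall>j\<in>J. (\<Sum>i\<in>M. c i * L i j) = 0)"
  using assms
proof (induction J arbitrary: M L rule: finite_induct)
  case empty
  then have "M \<noteq> {}" by auto
  then show ?case by (intro exI[of _ "\<lambda>_. 1"]) auto
next
  case (insert j J)
  show ?case
  proof (cases "\<forall>i\<in>M. L i j = 0")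
    case True
    have "card J < card M" using insert by simp
    then obtain c where "\<exists>i\<in>M. c i \<noteq> 0" "\<forall>j\<in>J. (\<Sum>i\<in>M. c i * L i j) = 0"
      using insert by metis
    then show ?thesis using True by (intro exI[of _ c]) auto
  next
    case False
    then obtain p where p: "p \<in> M" "L p j \<noteq> 0" by auto
    let ?N = "M - {p}"
    define L' where "L' i l = L i l - L i j / L p j * L p l" for i l
    have "card J < card ?N" using insert p by simp
    then obtain c where c: "\<exists>i\<in>?N. c i \<noteq> 0" "\<forall>l\<in>J. (\<Sum>i\<in>?N. c i * L' i l) = 0"
      using insert.IH[of ?N L'] insert.prems by auto
    \<comment> \<open>The value of the pivot unknown that equation \<open>j\<close> forces.\<close>
    define q where "q = - (\<Sum>i\<in>?N. c i * L i j) / L p j"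
    have split: "(\<Sum>i\<in>M. (c(p := q)) i * L i l) = q * L p l + (\<Sum>i\<in>?N. c i * L i l)" for l
      using p insert.prems by (simp add: sum.remove[of M p])
    have "(\<Sum>i\<in>?N. c i * L' i l) = q * L p l + (\<Sum>i\<in>?N. c i * L i l)" for l
    proof -
      have "c i * L' i l = c i * L i l - c i * L i j * (L p l / L p j)" for i
        by (simp add: L'_def algebra_simps)
      then have "(\<Sum>i\<in>?N. c i * L' i l) =
          (\<Sum>i\<in>?N. c i * L i l) - (\<Sum>i\<in>?N. c i * L i j) * (L p l / L p j)"
        by (simp add: sum_subtractf sum_distrib_right sum_divide_distrib)
      then show ?thesis by (simp add: q_def)
    qed
    then have "(\<Sum>i\<in>M. (c(p := q)) i * L i l) = 0" if "l \<in> J" for l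
      using split c(2) that by simp
    moreover have "(\<Sum>i\<in>M. (c(p := q)) i * L i j) = 0"
      using split[of j] p(2) by (simp add: q_def)
    moreover have "\<exists>i\<in>M. (c(p := q)) i \<noteq> 0" using c(1) by auto
    ultimately show ?thesis by (intro exI[of _ "c(p := q)"]) auto
  qed
qed

subsection \<open>Iterated differences of set functions\<close>

text \<open>At \<open>{}\<close> this is the pairing of \<open>f\<close> with a polytabloid of
  two-row shape, the pairs being the columns of length two. Other base sets \<open>I\<close> serve
  the inductions below.\<close>

fun iter_diff :: "(nat set \<Rightarrow> real) \<Rightarrow> (nat \<times> nat) list \<Rightarrow> nat set \<Rightarrow> real" where
  "iter_diff f [] I = f I"
| "iter_diff f ((a, b) # ps) I = iter_diff f ps (insert a I) - iter_diff f ps (insert b I)"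

text \<open>The column antisymmetrizer, a product of factors 1 - (a b), acting on \<open>f\<close>.
  It is a signed sum of translates of \<open>f\<close>, so linear relations that hold for all
  translates pass to it.\<close>

fun antisymmetrize :: "(nat set \<Rightarrow> real) \<Rightarrow> (nat \<times> nat) list \<Rightarrow> nat set \<Rightarrow> real" where
  "antisymmetrize f [] S = f S"
| "antisymmetrize f ((a, b) # ps) S = antisymmetrize f ps S - antisymmetrize (\<lambda>I. f (transpose a b ` I)) ps S"

definition entries :: "(nat \<times> nat) list \<Rightarrow> nat list" where
  "entries ps = map fst ps @ map snd ps"

lemma iter_diff_image:
  "iter_diff f (map (map_prod \<pi> \<pi>) ps) (\<pi> ` I) = iter_diff (\<lambda>J. f (\<pi> ` J)) ps I"
  by (induction f ps I rule: iter_diff.induct) (simp_all flip: image_insert)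

lemma antisymmetrize_transpose:
  assumes "a \<notin> set (entries ps)" "b \<notin> set (entries ps)"
  shows "antisymmetrize (\<lambda>I. f (transpose a b ` I)) ps S = antisymmetrize f ps (transpose a b ` S)"
  using assms
proof (induction f ps S rule: antisymmetrize.induct)
  case (1 f S)
  then show ?case by simp
next
  case (2 f c d ps S)
  have *: "transpose a b \<circ> transpose c d = transpose c d \<circ> transpose a b"
    using 2 by (auto simp: fun_eq_iff transpose_def entries_def)
  have "(\<lambda>I. f (transpose a b ` transpose c d ` I)) = (\<lambda>I. f (transpose c d ` transpose a b ` I))"
    using * by (metis image_comp)
  then show ?case using 2 by (simp add: entries_def)
qed

text \<open>The transposition of \<open>a\<close> and \<open>b\<close> fixes such an
  \<open>S\<close>, so the two terms of its factor cancel.\<close>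

lemma antisymmetrize_eq_0:
  assumes "distinct (entries ps)" "(a, b) \<in> set ps" "a \<in> S \<longleftrightarrow> b \<in> S"
  shows "antisymmetrize f ps S = 0"
  using assms
proof (induction f ps S rule: antisymmetrize.induct)
  case (1 f S)
  then show ?case by simp
next
  case (2 f c d ps S)
  show ?case
  proof (cases "(a, b) = (c, d)")
    case True
    have "transpose c d ` S = S"
      using 2 True by (auto simp: transpose_def image_iff)
    moreover have "c \<notin> set (entries ps)" "d \<notin> set (entries ps)"
      using 2 by (auto simp: entries_def)
    ultimately show ?thesis using antisymmetrize_transpose by simp
  next
    case False
    then show ?thesis using 2 by (auto simp: entries_def)
  qed
qed

text \<open>Swapping a pair replaces its first entry by its second, so the signed sum over swaps
  runs over the same transversals that \<open>iter_diff\<close> inserts.\<close>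

lemma antisymmetrize_firsts:
  assumes "distinct (entries ps)" "I \<inter> set (entries ps) = {}"
  shows "antisymmetrize f ps (I \<union> fst ` set ps) = iter_diff f ps I"
  using assms
proof (induction f ps I rule: iter_diff.induct)
  case (1 f I)
  then show ?case by simp
next
  case (2 f a b ps I)
  have ab: "a \<notin> set (entries ps)" "b \<notin> set (entries ps)" "a \<noteq> b" "a \<notin> I" "b \<notin> I"
    using 2 by (auto simp: entries_def)
  have "transpose a b ` (I \<union> fst ` set ((a, b) # ps)) = insert b I \<union> fst ` set ps"
  proof -
    have "transpose a b ` (I \<union> fst ` set ps) = I \<union> fst ` set ps"
      using ab by (intro image_cong[THEN trans, OF refl _ image_ident])
        (auto simp: transpose_def entries_def)
    then show ?thesis by (simp add: image_Un)
  qed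
  moreover have "antisymmetrize f ps (insert a I \<union> fst ` set ps) = iter_diff f ps (insert a I)"
    and "antisymmetrize f ps (insert b I \<union> fst ` set ps) = iter_diff f ps (insert b I)"
    using 2 by (auto simp: entries_def)
  ultimately show ?case using ab by (simp add: antisymmetrize_transpose)
qed

text \<open>The assumption on \<open>f\<close> is the identity \<open>marginal_sum_insert\<close>.
  On subtracting its instances at \<open>insert a I\<close> and \<open>insert b I\<close>, the terms
  containing both \<open>a\<close> and \<open>b\<close> cancel, so a pair lowers the factor by one,
  just as an element of \<open>I\<close> does.\<close>

lemma iter_diff_sum:
  assumes f: "\<And>I. I \<subseteq> {..<n} \<Longrightarrow> (\<Sum>x\<in>{..<n} - I. f (insert x I)) = (real k - real (card I)) * f I"
    and "distinct (entries ps)" "set (entries ps) \<subseteq> {..<n}" "I \<subseteq> {..<n}" "I \<inter> set (entries ps) = {}"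
  shows "(\<Sum>x\<in>{..<n} - I - set (entries ps). iter_diff f ps (insert x I)) =
    (real k - real (length ps) - real (card I)) * iter_diff f ps I"
  using assms(2-)
proof (induction ps arbitrary: I)
  case Nil
  then show ?case using f by (simp add: entries_def)
next
  case (Cons p ps)
  obtain a b where p: "p = (a, b)" by fastforce
  let ?E = "set (entries ps)"
  let ?X = "{..<n} - I - set (entries (p # ps))"
  have ab: "a \<notin> ?E" "b \<notin> ?E" "a \<noteq> b" "a \<notin> I" "b \<notin> I" "a < n" "b < n"
    using Cons.prems p by (auto simp: entries_def)
  have fin: "finite I" using Cons.prems finite_subset by blast
  have IH: "(\<Sum>x\<in>{..<n} - insert c I - ?E. iter_diff f ps (insert x (insert c I))) =
      (real k - real (length (p # ps)) - real (card I)) * iter_diff f ps (insert c I)"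
    if "c = a \<or> c = b" for c
  proof -
    have "(\<Sum>x\<in>{..<n} - insert c I - ?E. iter_diff f ps (insert x (insert c I))) =
      (real k - real (length ps) - real (card (insert c I))) * iter_diff f ps (insert c I)"
      by (rule Cons.IH) (use that ab Cons.prems p in \<open>auto simp: entries_def\<close>)
    moreover have "card (insert c I) = Suc (card I)" using that ab fin by auto
    ultimately show ?thesis by simp
  qed
  have "{..<n} - insert a I - ?E = insert b ?X" "{..<n} - insert b I - ?E = insert a ?X"
    and "a \<notin> ?X" "b \<notin> ?X" "finite ?X"
    using ab p by (auto simp: entries_def)
  then have
    "(\<Sum>x\<in>?X. iter_diff f ps (insert x (insert a I))) + iter_diff f ps (insert b (insert a I)) =
      (real k - real (length (p # ps)) - real (card I)) * iter_diff f ps (insert a I)"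
    "(\<Sum>x\<in>?X. iter_diff f ps (insert x (insert b I))) + iter_diff f ps (insert a (insert b I)) =
      (real k - real (length (p # ps)) - real (card I)) * iter_diff f ps (insert b I)"
    using IH[of a] IH[of b] by simp_all
  then show ?case
    by (simp add: p sum_subtractf insert_commute algebra_simps)
qed

text \<open>Trading an element \<open>x\<close> of \<open>I\<close> for a pair \<open>(x, y)\<close>
  keeps \<open>card I + length ps\<close>. The longer difference vanishes by induction, so the value
  at \<open>insert y I\<close> is independent of \<open>y\<close>; by \<open>iter_diff_sum\<close>
  these equal values add up to a multiple of the value at \<open>I\<close>, which is 0.\<close>

lemma iter_diff_eq_0_if_empty_eq_0:
  assumes f: "\<And>I. I \<subseteq> {..<n} \<Longrightarrow> (\<Sum>x\<in>{..<n} - I. f (insert x I)) = (real k - real (card I)) * f I"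
    and empty: "\<And>ps. distinct (entries ps) \<Longrightarrow> set (entries ps) \<subseteq> {..<n} \<Longrightarrow>
      r \<le> length ps \<Longrightarrow> length ps \<le> k \<Longrightarrow> iter_diff f ps {} = 0"
    and "distinct (entries ps)" "set (entries ps) \<subseteq> {..<n}" "r \<le> length ps"
    and "I \<subseteq> {..<n}" "I \<inter> set (entries ps) = {}" "card I + length ps \<le> k"
  shows "iter_diff f ps I = 0"
proof -
  have "finite I" using assms finite_subset by blast
  then show ?thesis using assms(3-)
  proof (induction I arbitrary: ps rule: finite_induct)
    case empty
    then show ?case using assms(2) by auto
  next
    case (insert x I)
    let ?X = "{..<n} - I - set (entries ps)"
    have "iter_diff f ps (insert y I) = iter_diff f ps (insert x I)" if "y \<in> ?X" for y
    proof (cases "y = x")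
      case False
      have "iter_diff f ((x, y) # ps) I = 0"
        by (rule insert.IH) (use insert that False in \<open>auto simp: entries_def\<close>)
      then show ?thesis by simp
    qed simp
    moreover have "iter_diff f ps I = 0"
      by (rule insert.IH) (use insert in auto)
    ultimately have "real (card ?X) * iter_diff f ps (insert x I) = 0"
      using iter_diff_sum[of n f k ps I] f insert.prems by auto
    moreover have "x \<in> ?X" using insert by auto
    then have "card ?X \<noteq> 0" by auto
    ultimately show ?case by simp
  qed
qed

subsection \<open>Ballot sets\<close>

text \<open>These are the second rows of the standard Young tableaux of shape \<open>(n - i, i)\<close>.\<close>

definition ballot_sets :: "nat \<Rightarrow> nat \<Rightarrow> nat set set" where
  "ballot_sets n i =
    {S. S \<subseteq> {..<n} \<and> card S = i \<and> (\<exists>b. inj_on b S \<and> (\<forall>s\<in>S. b s < s \<and> b s \<notin> S))}"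

lemma finite_ballot_sets [simp]: "finite (ballot_sets n i)"
  by (rule finite_subset[of _ "Pow {..<n}"]) (auto simp: ballot_sets_def)

text \<open>\<open>S\<close> and its partners under \<open>b\<close> fill at most
  \<open>2 * i\<close> of the \<open>n\<close> points, so a free point remains as partner of the new
  point \<open>n\<close>.\<close>

lemma insert_ballot_set:
  assumes "S \<in> ballot_sets n i" "2 * i + 1 \<le> n"
  shows "insert n S \<in> ballot_sets (Suc n) (Suc i)"
proof -
  obtain b where S: "S \<subseteq> {..<n}" "card S = i" and b: "inj_on b S" "\<forall>s\<in>S. b s < s \<and> b s \<notin> S"
    using assms(1) by (auto simp: ballot_sets_def)
  have fin: "finite S" using S finite_subset by blast
  have "card (S \<union> b ` S) \<le> i + i"
    using card_Un_le[of S "b ` S"] card_image[OF b(1)] S by simp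
  then have "card (S \<union> b ` S) < card {..<n}" using assms(2) by simp
  then have "\<not> {..<n} \<subseteq> S \<union> b ` S"
    using fin card_mono[of "S \<union> b ` S" "{..<n}"] by auto
  then obtain x where x: "x < n" "x \<notin> S" "x \<notin> b ` S" by auto
  have n: "n \<notin> S" using S by auto
  have "inj_on (b(n := x)) (insert n S)"
    using b(1) x n by (auto simp: inj_on_def)
  moreover have "(b(n := x)) s < s \<and> (b(n := x)) s \<notin> insert n S" if "s \<in> insert n S" for s
    using that b(2) x S by fastforce
  moreover have "insert n S \<subseteq> {..<Suc n}" "card (insert n S) = Suc i"
    using S n fin by auto
  ultimately show ?thesis unfolding ballot_sets_def by blast
qed

text \<open>Pascal's rule: the ballot sets avoiding the new point \<open>n\<close> and those
  obtained by adding it are disjoint families.\<close>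

lemma card_ballot_sets_Suc:
  assumes "2 * i + 1 \<le> n"
  shows "card (ballot_sets n (Suc i)) + card (ballot_sets n i) \<le> card (ballot_sets (Suc n) (Suc i))"
proof -
  have notin: "n \<notin> S" if "S \<in> ballot_sets n j" for S j
    using that by (auto simp: ballot_sets_def)
  have "inj_on (insert n) (ballot_sets n i)"
    using notin by (meson inj_onI insert_ident)
  then have "card (ballot_sets n i) = card (insert n ` ballot_sets n i)"
    by (simp add: card_image)
  moreover have "ballot_sets n (Suc i) \<inter> insert n ` ballot_sets n i = {}"
    using notin by auto
  moreover have "ballot_sets n (Suc i) \<subseteq> ballot_sets (Suc n) (Suc i)"
    by (auto simp: ballot_sets_def)
  moreover have "insert n ` ballot_sets n i \<subseteq> ballot_sets (Suc n) (Suc i)"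
    using assms insert_ballot_set by auto
  ultimately show ?thesis
    by (metis card_Un_disjoint card_mono finite_ballot_sets finite_imageI le_sup_iff)
qed

lemma card_ballot_sets_1: "n \<le> card (ballot_sets n 1) + 1"
proof (induction n)
  case (Suc n)
  have "ballot_sets n 0 = {{}}"
    by (auto simp: ballot_sets_def dest: finite_subset)
  then show ?case
    using Suc card_ballot_sets_Suc[of 0 n] by (cases "n = 0") auto
qed simp

text \<open>\<open>n * (n - 3) / 2\<close> is the dimension of the Specht module of shape
  \<open>(n - 2, 2)\<close>. For \<open>2 * i = n\<close> with \<open>i > 2\<close> the Pascal step
  uses just the summand for \<open>i - 1\<close>, hence the weaker bound, which is the main one
  taken at \<open>n - 1\<close>.\<close>

lemma card_ballot_sets:
  assumes "2 \<le> i" "2 * i \<le> n"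
  shows "(if i = 2 \<or> 2 * i < n then int n * (int n - 3) else (int n - 1) * (int n - 4))
    \<le> 2 * int (card (ballot_sets n i))"
  using assms
proof (induction n arbitrary: i)
  case (Suc n)
  define j where "j = i - 1"
  have i: "i = Suc j" "1 \<le> j" using Suc.prems by (auto simp: j_def)
  have step: "int (card (ballot_sets n i)) + int (card (ballot_sets n j)) \<le>
      int (card (ballot_sets (Suc n) i))"
    using card_ballot_sets_Suc[of j n] Suc.prems i by simp
  consider "j = 1" "n = 3" | "j = 1" "4 \<le> n" | "2 \<le> j" by (use i Suc.prems in linarith)
  then show ?case
  proof cases
    case 1
    then have "2 \<le> card (ballot_sets n 1)" using card_ballot_sets_1[of n] by simp
    then show ?thesis using step 1 i by simp
  next
    case 2
    have "int n * (int n - 3) \<le> 2 * int (card (ballot_sets n i))"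
      using Suc.IH[of i] 2 i by auto
    then show ?thesis
      using step card_ballot_sets_1[of n] 2 i by (auto simp: algebra_simps)
  next
    case 3
    have *: "int n * (int n - 3) \<le> 2 * int (card (ballot_sets n j))"
      using Suc.IH[of j] 3 Suc.prems i by simp
    consider "Suc n = 2 * i" | "n = 2 * i" | "2 * i < n" using Suc.prems by linarith
    then show ?thesis
    proof cases
      case 1
      then have "i \<noteq> 2" "\<not> 2 * i < Suc n" using 3 i by auto
      moreover have "int n * (int n - 3) \<le> 2 * int (card (ballot_sets (Suc n) i))"
        using * step by linarith
      ultimately show ?thesis by simp
    next
      case 2
      then have "(int n - 1) * (int n - 4) \<le> 2 * int (card (ballot_sets n i))"
        using Suc.IH[of i] 3 i by simp
      moreover have "6 \<le> int n" using 2 3 i by simp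
      \<comment> \<open>\<open>(n - 6) * (n - 1)\<close> is the surplus of the sum of the two bounds
        over the required \<open>(n + 1) * (n - 2)\<close>.\<close>
      then have "0 \<le> (int n - 6) * (int n - 1)" by simp
      ultimately show ?thesis using * step 2 by (auto simp: algebra_simps)
    next
      case large: 3
      then have "int n * (int n - 3) \<le> 2 * int (card (ballot_sets n i))"
        using Suc.IH[of i] 3 i by simp
      moreover have "6 \<le> int n" using 3 large i by simp
      then have "0 \<le> (int n - 6) * (int n - 1)" by simp
      ultimately show ?thesis using * step large \<open>6 \<le> int n\<close> by (auto simp: algebra_simps)
    qed
  qed
qed simp

subsection \<open>Marginals of functions on the symmetric group\<close>

text \<open>Inclusion agrees with equality on \<open>k\<close>-sets and extends the function to
  smaller sets, so that differences along fewer than \<open>k\<close> pairs can be taken at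
  \<open>{}\<close>.\<close>

definition marginal :: "nat \<Rightarrow> nat \<Rightarrow> ((nat \<Rightarrow> nat) \<Rightarrow> real) \<Rightarrow> nat set \<Rightarrow> real" where
  "marginal n k t I = (\<Sum>\<sigma> | \<sigma> permutes {..<n} \<and> \<sigma> ` I \<subseteq> {..<k}. t \<sigma>)"

lemma finite_permutes [simp]: "finite {\<sigma>. \<sigma> permutes {..<n::nat} \<and> Q \<sigma>}"
  by (rule finite_subset[OF _ finite_permutations[of "{..<n}"]]) auto

lemma marginal_translate:
  assumes \<pi>: "\<pi> permutes {..<n}"
    and u: "\<And>\<sigma>. \<sigma> permutes {..<n} \<Longrightarrow> u \<sigma> = t (\<sigma> \<circ> \<pi>)"
  shows "marginal n k u (\<pi> ` I) = marginal n k t I"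
  unfolding marginal_def
  using \<pi> u
  by (intro sum.reindex_bij_witness[of _ "\<lambda>\<sigma>. \<sigma> \<circ> inv \<pi>" "\<lambda>\<sigma>. \<sigma> \<circ> \<pi>"])
    (auto simp: permutes_compose permutes_inv permutes_inv_o o_assoc[symmetric] image_image
      permutes_inverses(2)[OF \<pi>])

text \<open>Double counting: each \<open>\<sigma>\<close> on the right sends exactly
  \<open>k - card I\<close> points outside \<open>I\<close> below \<open>k\<close>, and occurs that
  often on the left.\<close>

lemma marginal_sum_insert:
  assumes "k \<le> n" "I \<subseteq> {..<n}"
  shows "(\<Sum>x\<in>{..<n} - I. marginal n k t (insert x I)) = (real k - real (card I)) * marginal n k t I"
proof -
  let ?G = "{\<sigma>. \<sigma> permutes {..<n} \<and> \<sigma> ` I \<subseteq> {..<k}}"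
  have fin: "finite I" using assms finite_subset by blast
  have "marginal n k t (insert x I) = (\<Sum>\<sigma>\<in>?G. if \<sigma> x < k then t \<sigma> else 0)" for x
    unfolding marginal_def
    by (subst sum.inter_filter[symmetric]) (auto intro!: sum.cong)
  then have "(\<Sum>x\<in>{..<n} - I. marginal n k t (insert x I)) =
      (\<Sum>\<sigma>\<in>?G. \<Sum>x\<in>{..<n} - I. if \<sigma> x < k then t \<sigma> else 0)"
    by (simp add: sum.swap[of _ ?G])
  also have "\<dots> = (\<Sum>\<sigma>\<in>?G. (real k - real (card I)) * t \<sigma>)"
  proof (rule sum.cong[OF refl])
    fix \<sigma> assume \<sigma>: "\<sigma> \<in> ?G"
    then have p: "\<sigma> permutes {..<n}" by simp
    have "\<sigma> ` {x \<in> {..<n}. \<sigma> x < k} = {..<k}"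
    proof
      show "{..<k} \<subseteq> \<sigma> ` {x \<in> {..<n}. \<sigma> x < k}"
      proof
        fix y assume "y \<in> {..<k}"
        then have "y \<in> \<sigma> ` {..<n}" using permutes_image[OF p] assms by auto
        then show "y \<in> \<sigma> ` {x \<in> {..<n}. \<sigma> x < k}" using \<open>y \<in> {..<k}\<close> by auto
      qed
    qed auto
    moreover have "inj_on \<sigma> {x \<in> {..<n}. \<sigma> x < k}"
      using permutes_inj_on[OF p] .
    ultimately have "card {x \<in> {..<n}. \<sigma> x < k} = k"
      by (metis card_image card_lessThan)
    moreover have "{x \<in> {..<n} - I. \<sigma> x < k} = {x \<in> {..<n}. \<sigma> x < k} - I" by auto
    moreover have sub: "I \<subseteq> {x \<in> {..<n}. \<sigma> x < k}" using \<sigma> assms by auto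
    ultimately have "card {x \<in> {..<n} - I. \<sigma> x < k} = k - card I" "card I \<le> k"
      using card_Diff_subset[OF fin sub] card_mono[OF _ sub] by auto
    moreover have "(\<Sum>x\<in>{..<n} - I. if \<sigma> x < k then t \<sigma> else 0) =
        real (card {x \<in> {..<n} - I. \<sigma> x < k}) * t \<sigma>"
      by (subst sum.inter_filter[symmetric]) auto
    ultimately show "(\<Sum>x\<in>{..<n} - I. if \<sigma> x < k then t \<sigma> else 0) =
        (real k - real (card I)) * t \<sigma>"
      by (simp add: of_nat_diff)
  qed
  finally show ?thesis by (simp add: marginal_def sum_distrib_left)
qed

section \<open>Families of functions on the symmetric group closed under right translation\<close>

locale translation_closed =
  fixes n K :: nat and t :: "nat \<Rightarrow> (nat \<Rightarrow> nat) \<Rightarrow> real"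
  assumes closed: "\<And>\<pi> i. \<pi> permutes {..<n} \<Longrightarrow> i < K \<Longrightarrow>
    \<exists>j<K. \<forall>\<sigma>. \<sigma> permutes {..<n} \<longrightarrow> t j \<sigma> = t i (\<sigma> \<circ> \<pi>)"
begin

lemma ex_translate_marginal:
  assumes "\<pi> permutes {..<n}" "i < K"
  shows "\<exists>j<K. \<forall>k I. marginal n k (t j) (\<pi> ` I) = marginal n k (t i) I"
  using closed[OF assms] marginal_translate[OF assms(1)] by metis

text \<open>A relation satisfied by every member is satisfied by its translates under
  transpositions, hence by each term of the antisymmetrization.\<close>

lemma sum_antisymmetrize_eq_0:
  assumes rel: "\<And>j. j < K \<Longrightarrow> (\<Sum>S\<in>M. c S * marginal n k (t j) S) = 0"
    and "set (entries ps) \<subseteq> {..<n}" "j < K"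
  shows "(\<Sum>S\<in>M. c S * antisymmetrize (marginal n k (t j)) ps S) = 0"
  using assms(2-)
proof (induction ps arbitrary: j)
  case Nil
  then show ?case using rel by simp
next
  case (Cons p ps)
  obtain a b where p: "p = (a, b)" by fastforce
  let ?\<tau> = "transpose a b"
  have "?\<tau> permutes {..<n}"
    using Cons.prems p by (intro permutes_swap_id) (auto simp: entries_def)
  then obtain j' where j': "j' < K" "\<And>k I. marginal n k (t j') (?\<tau> ` I) = marginal n k (t j) I"
    using ex_translate_marginal Cons.prems by metis
  have "marginal n k (t j) (?\<tau> ` I) = marginal n k (t j') I" for I
    using j'(2)[of k "?\<tau> ` I"] by (simp add: image_image)
  then show ?case
    using Cons.IH[of j] Cons.IH[of j'] Cons.prems j'(1)
    by (simp add: p right_diff_distrib sum_subtractf entries_def)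
qed

text \<open>The translates of a function that is not annihilated by an \<open>i\<close>-fold difference span at
  least the dimension of the Specht module of shape \<open>(n - i, i)\<close>. A linear relation between the
  values on ballot sets is refuted at a ballot set \<open>S\<close> of least element sum in its support:
  antisymmetrizing along the matching of \<open>S\<close> leaves only sets that are transversal to this
  matching, and among these \<open>S\<close> has the strictly largest element sum.\<close>

lemma card_ballot_sets_le:
  assumes ps: "distinct (entries ps)" "set (entries ps) \<subseteq> {..<n}"
    and j: "j < K" "iter_diff (marginal n k (t j)) ps {} \<noteq> 0"
  shows "card (ballot_sets n (length ps)) \<le> K"
proof (rule ccontr)
  let ?M = "ballot_sets n (length ps)"
  assume "\<not> card ?M \<le> K"
  then obtain c where c: "\<exists>S\<in>?M. c S \<noteq> 0"
      "\<And>l. l < K \<Longrightarrow> (\<Sum>S\<in>?M. c S * marginal n k (t l) S) = 0"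
    using underdetermined_system[of "{..<K}" ?M "\<lambda>S l. marginal n k (t l) S"] by auto
  define S where "S = arg_min_on (\<lambda>S. \<Sum>S) {S \<in> ?M. c S \<noteq> 0}"
  have S: "S \<in> ?M" "c S \<noteq> 0"
    using arg_min_if_finite(1)[of "{S \<in> ?M. c S \<noteq> 0}" "\<lambda>S. \<Sum>S"] c(1) by (auto simp: S_def)
  have least: "\<Sum>S \<le> \<Sum>S'" if "S' \<in> ?M" "c S' \<noteq> 0" for S'
    using arg_min_least[of "{S \<in> ?M. c S \<noteq> 0}" S' "\<lambda>S. \<Sum>S"] that by (auto simp: S_def)
  obtain b where sub: "S \<subseteq> {..<n}" and card: "card S = length ps"
    and b: "inj_on b S" "\<And>s. s \<in> S \<Longrightarrow> b s < s" "\<And>s. s \<in> S \<Longrightarrow> b s \<notin> S"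
    using S(1) by (auto simp: ballot_sets_def)
  have fin: "finite S" using sub finite_subset by blast
  then obtain xs where xs: "set xs = S" "distinct xs" using finite_distinct_list by blast
  define qs where "qs = map (\<lambda>s. (s, b s)) xs"
  have entries_qs: "entries qs = xs @ map b xs" by (simp add: qs_def entries_def comp_def)
  have "b s < n" if "s \<in> S" for s
    using b(2)[OF that] sub that by force
  then have qs: "distinct (entries qs)" "set (entries qs) \<subseteq> {..<n}"
    using xs b sub by (auto simp: entries_qs distinct_map)
  have len: "length qs = length ps" "fst ` set qs = S"
    using xs card distinct_card[OF xs(2)] by (auto simp: qs_def image_image)
  \<comment> \<open>Relabelling by \<open>\<pi>\<close> carries the given pairs to the matching of
    \<open>S\<close>, so some translate of \<open>t j\<close> has a nonzero difference along
    \<open>qs\<close>.\<close>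
  obtain \<pi> where \<pi>: "\<pi> permutes {..<n}" "map \<pi> (entries ps) = entries qs"
    using ex_permutes_map_eq[of "entries ps" "entries qs" "{..<n}"] ps qs len by (auto simp: entries_def)
  have map_qs: "map (map_prod \<pi> \<pi>) ps = qs"
  proof -
    have "map (\<pi> \<circ> fst) ps = map fst qs" "map (\<pi> \<circ> snd) ps = map snd qs"
      using \<pi>(2) len(1) by (auto simp: entries_def)
    then have "zip (map (\<pi> \<circ> fst) ps) (map (\<pi> \<circ> snd) ps) = qs" by (simp add: zip_map_fst_snd)
    then show ?thesis by (simp add: zip_map_map zip_same_conv_map map_prod_def case_prod_unfold comp_def)
  qed
  obtain l where l: "l < K" "\<And>k I. marginal n k (t l) (\<pi> ` I) = marginal n k (t j) I"
    using ex_translate_marginal[OF \<pi>(1) j(1)] by metis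
  let ?g = "antisymmetrize (marginal n k (t l)) qs"
  have "?g S = iter_diff (marginal n k (t l)) qs {}"
    using antisymmetrize_firsts[of qs "{}"] qs len by simp
  also have "\<dots> \<noteq> 0"
    using iter_diff_image[of "marginal n k (t l)" \<pi> ps "{}"] l(2) map_qs j(2) by simp
  finally have "?g S \<noteq> 0" .
  moreover have "c S' * ?g S' = 0" if S': "S' \<in> ?M" "S' \<noteq> S" for S'
  proof (rule ccontr)
    assume *: "c S' * ?g S' \<noteq> 0"
    have transv: "s \<in> S' \<longleftrightarrow> b s \<notin> S'" if "s \<in> S" for s
      using antisymmetrize_eq_0[OF qs(1), of s "b s" S'] that * xs by (auto simp: qs_def)
    have S'c: "card S' = card S" "finite S'"
      using S' card finite_subset[of S'] by (auto simp: ballot_sets_def)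
    \<comment> \<open>\<open>\<phi>\<close> selects from each matched pair the entry that lies in
      \<open>S'\<close>.\<close>
    define \<phi> where "\<phi> s = (if s \<in> S' then s else b s)" for s
    have inj: "inj_on \<phi> S" using b by (auto simp: \<phi>_def inj_on_def)
    moreover have "\<phi> ` S \<subseteq> S'" using transv by (auto simp: \<phi>_def)
    ultimately have "\<phi> ` S = S'"
      using S'c by (metis card_image card_subset_eq)
    then have "\<Sum>S' = sum \<phi> S" using inj by (metis sum.reindex_cong)
    moreover obtain s where "s \<in> S" "s \<notin> S'"
      using S' S'c fin by (metis card_subset_eq subsetI)
    then have "sum \<phi> S < \<Sum>S"
      using b(2) fin by (intro sum_strict_mono_ex1) (auto simp: \<phi>_def less_imp_le)
    ultimately show False using least[OF S'(1)] * by auto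
  qed
  then have "(\<Sum>S'\<in>?M - {S}. c S' * ?g S') = 0" by (intro sum.neutral) blast
  then have "(\<Sum>S'\<in>?M. c S' * ?g S') = c S * ?g S"
    using S(1) by (simp add: sum.remove[of _ S])
  ultimately show False
    using sum_antisymmetrize_eq_0[OF c(2) qs(2) l(1)] S(2) by simp
qed

end

section \<open>Small families: marginals on \<open>k\<close>-sets depend on a single point\<close>

context translation_closed
begin

text \<open>If the pairs cover all points, the sum in \<open>iter_diff_sum\<close> is empty while
  \<open>2 * k \<noteq> n\<close> makes its factor nonzero. Otherwise a nonzero value gives
  \<open>n * (n - 3) \<le> 2 * K\<close>, which together with the bound on \<open>K\<close> forces
  \<open>n < 5\<close>.\<close>

lemma iter_diff_marginal_empty_eq_0:
  assumes n: "6 \<le> n" and K: "4 * K < n * (n - 1)" and j: "j < K" and k: "k \<le> n" "2 * k \<noteq> n"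
    and ps: "distinct (entries ps)" "set (entries ps) \<subseteq> {..<n}" "2 \<le> length ps" "length ps \<le> k"
  shows "iter_diff (marginal n k (t j)) ps {} = 0"
proof (rule ccontr)
  assume *: "iter_diff (marginal n k (t j)) ps {} \<noteq> 0"
  have len: "card (set (entries ps)) = 2 * length ps"
    using distinct_card[OF ps(1)] by (simp add: entries_def)
  show False
  proof (cases "2 * length ps = n")
    case True
    then have "{..<n} - {} - set (entries ps) = {}"
      using ps(2) len by (metis Diff_cancel Diff_empty card_lessThan card_subset_eq finite_lessThan)
    then have "(real k - real (length ps)) * iter_diff (marginal n k (t j)) ps {} = 0"
      using iter_diff_sum[of n "marginal n k (t j)" k ps "{}"] marginal_sum_insert[OF k(1)] ps by simp
    then show False using * True k by simp
  next
    case False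
    then have "2 * length ps < n"
      using len card_mono[OF _ ps(2)] by simp
    then have "int n * (int n - 3) \<le> 2 * int K"
      using card_ballot_sets[of "length ps" n] card_ballot_sets_le[OF ps(1,2) j *] ps(3) by simp
    moreover have "4 * int K < int n * (int n - 1)"
    proof -
      have "int (4 * K) < int (n * (n - 1))" using K by (simp only: of_nat_less_iff)
      then show ?thesis using n by (simp add: of_nat_diff)
    qed
    moreover have "6 * int n \<le> int n * int n" using n by (intro mult_right_mono) auto
    ultimately show False using n by (simp add: algebra_simps)
  qed
qed

lemma iter_diff_marginal_eq_0:
  assumes "6 \<le> n" "4 * K < n * (n - 1)" "j < K" "k \<le> n" "2 * k \<noteq> n"
    and "distinct (entries ps)" "set (entries ps) \<subseteq> {..<n}" "2 \<le> length ps"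
    and "I \<subseteq> {..<n}" "I \<inter> set (entries ps) = {}" "card I + length ps \<le> k"
  shows "iter_diff (marginal n k (t j)) ps I = 0"
  using iter_diff_eq_0_if_empty_eq_0[of n "marginal n k (t j)" k 2 ps I]
    marginal_sum_insert[OF assms(4)] iter_diff_marginal_empty_eq_0[OF assms(1-5)] assms by blast

text \<open>Second differences vanish, so the difference along \<open>(a, b)\<close> has the same
  value at \<open>insert y R\<close> for every admissible \<open>y\<close>. By
  \<open>iter_diff_sum\<close> a nonzero multiple of it equals \<open>k - 1 - card R\<close> times
  the value at \<open>R\<close>, and this factor is positive while the enlarged set still has fewer
  than \<open>k\<close> points.\<close>

lemma marginal_exchange_iff:
  assumes small: "6 \<le> n" "4 * K < n * (n - 1)" "j < K" "k \<le> n" "2 * k \<noteq> n"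
    and ab: "a < n" "b < n" "a \<noteq> b"
    and R: "R \<subseteq> {..<n}" "a \<notin> R" "b \<notin> R" "card R < k"
  shows "marginal n k (t j) (insert a R) = marginal n k (t j) (insert b R) \<longleftrightarrow>
    marginal n k (t j) {a} = marginal n k (t j) {b}"
proof -
  let ?D = "iter_diff (marginal n k (t j)) [(a, b)]"
  have "finite R" using R finite_subset by blast
  then have "?D R = 0 \<longleftrightarrow> ?D {} = 0" using R
  proof (induction R rule: finite_induct)
    case empty
    then show ?case by simp
  next
    case (insert x R)
    let ?X = "{..<n} - R - set (entries [(a, b)])"
    have "?D (insert y R) = ?D (insert x R)" if "y \<in> ?X" for y
    proof (cases "y = x")
      case False
      have "iter_diff (marginal n k (t j)) [(x, y), (a, b)] R = 0"
        by (rule iter_diff_marginal_eq_0[OF small])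
          (use insert that False ab in \<open>auto simp: entries_def\<close>)
      then show ?thesis by simp
    qed simp
    then have "(\<Sum>y\<in>?X. ?D (insert y R)) = real (card ?X) * ?D (insert x R)"
      by simp
    moreover have "(\<Sum>y\<in>?X. ?D (insert y R)) = (real k - 1 - real (card R)) * ?D R"
      using iter_diff_sum[of n "marginal n k (t j)" k "[(a, b)]" R] marginal_sum_insert[OF small(4)]
        ab insert.prems by (simp add: entries_def)
    moreover have "real k - 1 - real (card R) \<noteq> 0"
      using insert by simp
    moreover have "x \<in> ?X" using insert by (auto simp: entries_def)
    then have "card ?X \<noteq> 0" by auto
    ultimately have "?D (insert x R) = 0 \<longleftrightarrow> ?D R = 0"
      by (metis mult_eq_0_iff of_nat_eq_0_iff)
    then show ?case using insert by simp
  qed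
  then show ?thesis by simp
qed

text \<open>Translation by \<open>\<pi>\<close> moves the set of points with value in
  \<open>Y\<close> by \<open>\<pi>\<close>, so all sets of its size m arise from the
  \<open>K\<close> members; and n choose m is at least n choose 2 for m between 2 and n - 2.\<close>

lemma binomial_le_if_value_set:
  assumes "j < K" "2 \<le> card {v. v < n \<and> marginal n k (t j) {v} \<in> Y}"
    "card {v. v < n \<and> marginal n k (t j) {v} \<in> Y} + 2 \<le> n"
  shows "n choose 2 \<le> K"
proof -
  define F where "F l = {v. v < n \<and> marginal n k (t l) {v} \<in> Y}" for l
  let ?m = "card (F j)"
  have "{B. B \<subseteq> {..<n} \<and> card B = ?m} \<subseteq> F ` {..<K}"
  proof
    fix B assume "B \<in> {B. B \<subseteq> {..<n} \<and> card B = ?m}"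
    moreover have "F j \<subseteq> {..<n}" by (auto simp: F_def)
    ultimately obtain \<pi> where \<pi>: "\<pi> permutes {..<n}" "\<pi> ` F j = B"
      using ex_permutes_image_eq[of "{..<n}" "F j" B] by auto
    obtain l where l: "l < K" "\<And>k I. marginal n k (t l) (\<pi> ` I) = marginal n k (t j) I"
      using ex_translate_marginal[OF \<pi>(1) assms(1)] by metis
    have "\<pi> v \<in> F l \<longleftrightarrow> v \<in> F j" for v
      using l(2)[of k "{v}"] permutes_in_image[OF \<pi>(1), of v] by (simp add: F_def)
    then have "\<pi> ` F j = F l"
      using surj_f_inv_f[OF permutes_surj[OF \<pi>(1)]] by (auto simp: image_iff) metis
    then show "B \<in> F ` {..<K}" using \<pi>(2) l(1) by auto
  qed
  then have "card {B. B \<subseteq> {..<n} \<and> card B = ?m} \<le> card {..<K}"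
    by (rule surj_card_le[rotated]) simp
  then have *: "n choose ?m \<le> K" using n_subsets[of "{..<n}" ?m] by simp
  have m: "2 \<le> ?m" "?m + 2 \<le> n" using assms by (auto simp: F_def)
  have "n choose 2 \<le> n choose ?m"
  proof (cases "2 * ?m \<le> n")
    case True
    then show ?thesis using m by (intro binomial_mono) auto
  next
    case False
    have "n choose 2 \<le> n choose (n - ?m)"
      using m False by (intro binomial_mono) auto
    then show ?thesis using m binomial_symmetric[of ?m n] by simp
  qed
  then show ?thesis using * by simp
qed

text \<open>As n choose 2 exceeds \<open>K\<close>, no set of values is taken at between 2 and n - 2
  points. If no value is taken at n - 1 or more points, all values are distinct, and
  \<open>{w 0, w 1}\<close> is taken at exactly two points, a contradiction.\<close>

lemma ex_exceptional_point:
  assumes n: "6 \<le> n" and K: "4 * K < n * (n - 1)" and j: "j < K"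
  shows "\<exists>v0. \<forall>a<n. \<forall>b<n. a \<noteq> v0 \<longrightarrow> b \<noteq> v0 \<longrightarrow>
    marginal n k (t j) {a} = marginal n k (t j) {b}"
proof -
  define w where "w v = marginal n k (t j) {v}" for v
  have "2 * (n choose 2) = n * (n - 1)"
    by (cases n) (simp_all add: choose_two)
  then have Y: "card {v. v < n \<and> w v \<in> Y} < 2 \<or> n < card {v. v < n \<and> w v \<in> Y} + 2" for Y
    using binomial_le_if_value_set[OF j, of k Y] K by (force simp: w_def)
  show ?thesis
  proof (cases "\<exists>x. n < card {v. v < n \<and> w v = x} + 2")
    case True
    then obtain x where x: "n < card {v. v < n \<and> w v = x} + 2" by blast
    define B where "B = {..<n} - {v. v < n \<and> w v = x}"
    have "card B = n - card {v. v < n \<and> w v = x}"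
      unfolding B_def by (subst card_Diff_subset) auto
    then have "card B \<le> Suc 0" using x by linarith
    moreover have "finite B" by (simp add: B_def)
    ultimately have "\<forall>a\<in>B. \<forall>b\<in>B. a = b" using card_le_Suc0_iff_eq by blast
    then obtain v0 where "B \<subseteq> {v0}" by (cases "B = {}") blast+
    then have "{..<n} - {v. v < n \<and> w v = x} \<subseteq> {v0}" unfolding B_def .
    then have "w a = x" if "a < n" "a \<noteq> v0" for a using that by blast
    then show ?thesis by (auto simp: w_def intro!: exI[of _ v0])
  next
    case False
    have le1: "card {v. v < n \<and> w v = x} \<le> 1" for x
      using Y[of "{x}"] False[THEN not_ex[THEN iffD1], rule_format, of x] by simp
    have "{v. v < n \<and> w v \<in> {w 0, w 1}} = {v. v < n \<and> w v = w 0} \<union> {v. v < n \<and> w v = w 1}"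
      by auto
    then have "card {v. v < n \<and> w v \<in> {w 0, w 1}} \<le> 2"
      using card_Un_le[of "{v. v < n \<and> w v = w 0}" "{v. v < n \<and> w v = w 1}"]
        le1[of "w 0"] le1[of "w 1"] by simp
    moreover have "card {0::nat, 1} \<le> card {v. v < n \<and> w v \<in> {w 0, w 1}}"
      using n by (intro card_mono) auto
    ultimately show ?thesis using Y[of "{w 0, w 1}"] n by simp
  qed
qed

text \<open>Points of \<open>I - J\<close> are exchanged for points of \<open>J - I\<close> one at a
  time. By \<open>iff\<close> neither exchanged point is \<open>v0\<close>, so
  \<open>marginal_exchange_iff\<close> reduces each exchange to equal values at singletons.\<close>

lemma marginal_eq_if_exceptional_point:
  assumes small: "6 \<le> n" "4 * K < n * (n - 1)" "j < K" "k \<le> n" "2 * k \<noteq> n"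
    and v0: "\<And>a b. a < n \<Longrightarrow> b < n \<Longrightarrow> a \<noteq> v0 \<Longrightarrow> b \<noteq> v0 \<Longrightarrow>
      marginal n k (t j) {a} = marginal n k (t j) {b}"
    and I: "I \<subseteq> {..<n}" "card I = k" and J: "J \<subseteq> {..<n}" "card J = k"
    and iff: "v0 \<in> I \<longleftrightarrow> v0 \<in> J"
  shows "marginal n k (t j) I = marginal n k (t j) J"
  using I iff
proof (induction "card (I - J)" arbitrary: I)
  case 0
  have fin: "finite I" "finite J" using 0 J finite_subset by blast+
  then have "I \<subseteq> J" using 0 by simp
  then show ?case using card_subset_eq[OF fin(2), of I] 0 J by simp
next
  case (Suc m)
  have fin: "finite I" "finite J" using Suc.prems J finite_subset by blast+
  have "I - J \<noteq> {}" using Suc.hyps(2) by (metis card.empty nat.distinct(1))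
  then obtain a where a: "a \<in> I" "a \<notin> J" by blast
  then obtain b where b: "b \<in> J" "b \<notin> I"
    using card_subset_eq[OF fin(1), of J] Suc.prems J by auto
  let ?R = "I - {a}"
  have card: "card ?R < k" "card (insert b ?R) = k"
    using card_Suc_Diff1[OF fin(1) a(1)] b(2) fin(1) Suc.prems(2) by auto
  have ne: "a \<noteq> v0" "b \<noteq> v0" "a \<noteq> b" "a < n" "b < n"
    using a b Suc.prems J by auto
  have "marginal n k (t j) (insert a ?R) = marginal n k (t j) (insert b ?R)"
    by (rule marginal_exchange_iff[OF small ne(4,5,3) _ _ _ card(1), THEN iffD2])
      (use Suc.prems(1) b(2) v0[OF ne(4,5,1,2)] in \<open>auto simp only: Diff_iff singletonI\<close>)
  also have "\<dots> = marginal n k (t j) J"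
  proof (rule Suc.hyps(1))
    have "insert b ?R - J = (I - J) - {a}" using b by auto
    then show "m = card (insert b ?R - J)" using Suc.hyps(2) a fin by simp
  qed (use Suc.prems card ne J b in auto)
  finally show ?case using a by (simp add: insert_absorb)
qed

end

section \<open>Low and high members of the family, and their count\<close>

context translation_closed
begin

text \<open>The first and third clauses make \<open>k\<close> the least value of
  \<open>\<sigma> v\<close> on the support of \<open>t j\<close>, so \<open>j\<close> and
  \<open>v\<close> determine \<open>k\<close>; the second clause makes \<open>j\<close> determine
  \<open>v\<close>.\<close>

definition low :: "nat \<Rightarrow> nat \<Rightarrow> nat \<Rightarrow> bool" where
  "low j k v \<longleftrightarrow>
    (\<forall>\<sigma>. \<sigma> permutes {..<n} \<and> t j \<sigma> \<noteq> 0 \<longrightarrow> k \<le> \<sigma> v) \<and>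
    (\<forall>I\<subseteq>{..<n}. card I = k \<and> v \<notin> I \<longrightarrow> (\<exists>\<sigma>. \<sigma> permutes {..<n} \<and> t j \<sigma> \<noteq> 0 \<and> \<sigma> ` I = {..<k})) \<and>
    (\<exists>\<sigma>. \<sigma> permutes {..<n} \<and> t j \<sigma> \<noteq> 0 \<and> \<sigma> v = k)"

text \<open>The mirror image: \<open>k - 1\<close> is the greatest value of
  \<open>\<sigma> v\<close> on the support.\<close>

definition high :: "nat \<Rightarrow> nat \<Rightarrow> nat \<Rightarrow> bool" where
  "high j k v \<longleftrightarrow>
    (\<forall>\<sigma>. \<sigma> permutes {..<n} \<and> t j \<sigma> \<noteq> 0 \<longrightarrow> \<sigma> v < k) \<and>
    (\<forall>I\<subseteq>{..<n}. card I = k \<and> v \<in> I \<longrightarrow> (\<exists>\<sigma>. \<sigma> permutes {..<n} \<and> t j \<sigma> \<noteq> 0 \<and> \<sigma> ` I = {..<k})) \<and>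
    (\<exists>\<sigma>. \<sigma> permutes {..<n} \<and> t j \<sigma> \<noteq> 0 \<and> Suc (\<sigma> v) = k)"

lemma ex_set_avoiding_containing:
  assumes "1 \<le> k" "k < n" "v < n" "v' < n" "v \<noteq> v'"
  shows "\<exists>I\<subseteq>{..<n}. card I = k \<and> v \<notin> I \<and> v' \<in> I"
proof -
  have "k - 1 \<le> card ({..<n} - {v, v'})"
    using assms by (subst card_Diff_subset) auto
  then obtain J where J: "J \<subseteq> {..<n} - {v, v'}" "card J = k - 1" "finite J"
    using obtain_subset_with_card_n by blast
  then have "card (insert v' J) = k" using assms by (subst card_insert_disjoint) auto
  then show ?thesis using J assms by (intro exI[of _ "insert v' J"]) auto
qed

text \<open>If the points differ, a support element mapping a \<open>k\<close>-set that avoids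
  \<open>v\<close> and contains \<open>v'\<close> onto \<open>{..<k}\<close> has
  \<open>\<sigma> v' < k \<le> k'\<close>, a contradiction. For equal points, \<open>k\<close> is an
  attained value.\<close>

lemma low_unique:
  assumes "low j k v" "low j k' v'" "1 \<le> k" "k \<le> k'" "k' < n" "v < n" "v' < n"
  shows "k = k' \<and> v = v'"
proof -
  have "v = v'"
  proof (rule ccontr)
    assume "v \<noteq> v'"
    then obtain I where "I \<subseteq> {..<n}" "card I = k" "v \<notin> I" "v' \<in> I"
      using ex_set_avoiding_containing[of k v v'] assms by auto
    then obtain \<sigma> where "\<sigma> permutes {..<n}" "t j \<sigma> \<noteq> 0" "\<sigma> ` I = {..<k}" "\<sigma> v' \<in> \<sigma> ` I"
      using assms(1) unfolding low_def by blast
    moreover from this have "k' \<le> \<sigma> v'" using assms(2) unfolding low_def by blast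
    ultimately show False using assms(4) by auto
  qed
  moreover have "k' \<le> k" using assms(1,2) \<open>v = v'\<close> unfolding low_def by metis
  ultimately show ?thesis using assms(4) by simp
qed

text \<open>As for \<open>low_unique\<close>, but with a set of the larger size \<open>k'\<close>:
  it avoids \<open>v\<close>, so \<open>\<sigma> v \<ge> k' \<ge> k\<close>.\<close>

lemma high_unique:
  assumes "high j k v" "high j k' v'" "1 \<le> k" "k \<le> k'" "k' < n" "v < n" "v' < n"
  shows "k = k' \<and> v = v'"
proof -
  have "v = v'"
  proof (rule ccontr)
    assume "v \<noteq> v'"
    then obtain I where I: "I \<subseteq> {..<n}" "card I = k'" "v \<notin> I" "v' \<in> I"
      using ex_set_avoiding_containing[of k' v v'] assms by auto
    then obtain \<sigma> where \<sigma>: "\<sigma> permutes {..<n}" "t j \<sigma> \<noteq> 0" "\<sigma> ` I = {..<k'}"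
      using assms(2) unfolding high_def by blast
    then have "\<sigma> v \<notin> {..<k'}"
      using I(3) inj_image_mem_iff[OF permutes_inj[OF \<sigma>(1)]] by blast
    moreover have "\<sigma> v < k" using assms(1) \<sigma> by (simp add: high_def)
    ultimately show False using assms(4) by simp
  qed
  moreover have "k' \<le> k"
    using assms(1,2) \<open>v = v'\<close> unfolding high_def by (metis Suc_leI)
  ultimately show ?thesis using assms(4) by simp
qed

text \<open>Translating by the transposition of \<open>v\<close> and \<open>v'\<close> spreads one
  low or high pair for \<open>k\<close> to all \<open>n\<close> points.\<close>

lemma ex_translate:
  assumes "j < K" "v < n" "v' < n"
  shows "\<exists>l<K. \<forall>k. (low j k v \<longrightarrow> low l k v') \<and> (high j k v \<longrightarrow> high l k v')"
proof -
  let ?\<tau> = "transpose v v'"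
  have \<tau>: "?\<tau> permutes {..<n}" using assms by (intro permutes_swap_id) auto
  then obtain l where l: "l < K" "\<And>\<sigma>. \<sigma> permutes {..<n} \<Longrightarrow> t l \<sigma> = t j (\<sigma> \<circ> ?\<tau>)"
    using closed assms(1) by metis
  have comp: "\<sigma> \<circ> ?\<tau> permutes {..<n}" if "\<sigma> permutes {..<n}" for \<sigma>
    using permutes_compose[OF \<tau> that] .
  have inv_step: "t l (\<sigma> \<circ> ?\<tau>) = t j \<sigma>" if "\<sigma> permutes {..<n}" for \<sigma>
    using l(2)[OF comp[OF that]] by (simp add: o_assoc[symmetric])
  have sub: "?\<tau> ` I \<subseteq> {..<n}" "card (?\<tau> ` I) = card I" "v \<in> ?\<tau> ` I \<longleftrightarrow> v' \<in> I"
    if "I \<subseteq> {..<n}" for I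
    using that permutes_image[OF \<tau>] card_image[of ?\<tau> I] permutes_inj_on[OF \<tau>]
    by (auto simp: image_iff transpose_def split: if_splits)
  have ex1: "\<exists>\<sigma>. \<sigma> permutes {..<n} \<and> t l \<sigma> \<noteq> 0 \<and> \<sigma> ` I = {..<k}"
    if "\<exists>\<sigma>. \<sigma> permutes {..<n} \<and> t j \<sigma> \<noteq> 0 \<and> \<sigma> ` ?\<tau> ` I = {..<k}" for I k
    using that inv_step comp by (metis image_comp)
  have ex2: "\<exists>\<sigma>. \<sigma> permutes {..<n} \<and> t l \<sigma> \<noteq> 0 \<and> \<sigma> v' = x"
    if "\<exists>\<sigma>. \<sigma> permutes {..<n} \<and> t j \<sigma> \<noteq> 0 \<and> \<sigma> v = x" for x
    using that inv_step comp by (metis comp_apply transpose_apply_second)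
  have step: "(\<sigma> \<circ> ?\<tau>) permutes {..<n} \<and> t j (\<sigma> \<circ> ?\<tau>) \<noteq> 0 \<and> (\<sigma> \<circ> ?\<tau>) v = \<sigma> v'"
    if "\<sigma> permutes {..<n}" "t l \<sigma> \<noteq> 0" for \<sigma>
    using that l(2) comp by auto
  have "low l k v'" if "low j k v" for k
    unfolding low_def
  proof (intro conjI allI impI)
    show "k \<le> \<sigma> v'" if "\<sigma> permutes {..<n} \<and> t l \<sigma> \<noteq> 0" for \<sigma>
      using step[of \<sigma>] that \<open>low j k v\<close> unfolding low_def by metis
    show "\<exists>\<sigma>. \<sigma> permutes {..<n} \<and> t l \<sigma> \<noteq> 0 \<and> \<sigma> ` I = {..<k}"
      if "I \<subseteq> {..<n}" "card I = k \<and> v' \<notin> I" for I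
      using ex1 sub[OF that(1)] that(2) \<open>low j k v\<close> unfolding low_def by simp
    show "\<exists>\<sigma>. \<sigma> permutes {..<n} \<and> t l \<sigma> \<noteq> 0 \<and> \<sigma> v' = k"
      using ex2 \<open>low j k v\<close> unfolding low_def by simp
  qed
  moreover have "high l k v'" if "high j k v" for k
    unfolding high_def
  proof (intro conjI allI impI)
    show "\<sigma> v' < k" if "\<sigma> permutes {..<n} \<and> t l \<sigma> \<noteq> 0" for \<sigma>
      using step[of \<sigma>] that \<open>high j k v\<close> unfolding high_def by metis
    show "\<exists>\<sigma>. \<sigma> permutes {..<n} \<and> t l \<sigma> \<noteq> 0 \<and> \<sigma> ` I = {..<k}"
      if "I \<subseteq> {..<n}" "card I = k \<and> v' \<in> I" for I
      using ex1 sub[OF that(1)] that(2) \<open>high j k v\<close> unfolding high_def by simp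
    show "\<exists>\<sigma>. \<sigma> permutes {..<n} \<and> t l \<sigma> \<noteq> 0 \<and> Suc (\<sigma> v') = k"
      using ex2 \<open>high j k v\<close> unfolding high_def by metis
  qed
  ultimately show ?thesis using l(1) by blast
qed

text \<open>The marginal on \<open>k\<close>-sets depends only on whether they contain the
  exceptional point \<open>v\<close>, and it vanishes at \<open>{..<k}\<close>. Hence it vanishes on
  all \<open>k\<close>-sets on the same side of \<open>v\<close>: for \<open>v < k\<close> the
  support has \<open>\<sigma> v \<ge> k\<close>, otherwise \<open>\<sigma> v < k\<close>. The
  element \<open>\<sigma>0\<close> shows that the other side is nonzero and that the bound is
  attained.\<close>

lemma low_or_high:
  assumes small: "6 \<le> n" "4 * K < n * (n - 1)" "j < K"
    and k: "1 \<le> k" "k < n" "2 * k \<noteq> n"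
    and nonneg: "\<And>\<sigma>. \<sigma> permutes {..<n} \<Longrightarrow> 0 \<le> t j \<sigma>"
    and zero: "\<And>\<sigma>. \<sigma> permutes {..<n} \<Longrightarrow> \<sigma> ` {..<k} = {..<k} \<Longrightarrow> t j \<sigma> = 0"
    and \<sigma>0: "\<sigma>0 permutes {..<n}" "\<sigma>0 ` {..<k} = insert k {..<k - 1}" "t j \<sigma>0 \<noteq> 0"
  shows "\<exists>v<n. low j k v \<or> high j k v"
proof -
  have eq: "\<sigma> ` I = {..<k} \<longleftrightarrow> \<sigma> ` I \<subseteq> {..<k}"
    if "\<sigma> permutes {..<n}" "card I = k" for \<sigma> I
    using that card_image[OF permutes_inj_on[OF that(1)], of I]
    by (metis card_lessThan card_subset_eq equalityD1 finite_lessThan)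
  \<comment> \<open>Nonnegativity rules out cancellation within a marginal.\<close>
  have pos: "marginal n k (t j) I \<noteq> 0 \<longleftrightarrow>
      (\<exists>\<sigma>. \<sigma> permutes {..<n} \<and> t j \<sigma> \<noteq> 0 \<and> \<sigma> ` I = {..<k})" if "card I = k" for I
    unfolding marginal_def using nonneg eq[OF _ that]
    by (subst sum_nonneg_eq_0_iff) (auto, metis+)
  obtain v where v: "\<And>a b. a < n \<Longrightarrow> b < n \<Longrightarrow> a \<noteq> v \<Longrightarrow> b \<noteq> v \<Longrightarrow>
      marginal n k (t j) {a} = marginal n k (t j) {b}"
    using ex_exceptional_point[OF small] by metis
  have same: "marginal n k (t j) I = marginal n k (t j) J"
    if "I \<subseteq> {..<n}" "card I = k" "J \<subseteq> {..<n}" "card J = k" "v \<in> I \<longleftrightarrow> v \<in> J" for I J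
    using marginal_eq_if_exceptional_point[OF small _ k(3) v that] k by auto
  have preimage: "inv \<sigma> ` {..<k} \<subseteq> {..<n}" "card (inv \<sigma> ` {..<k}) = k"
      "\<sigma> ` inv \<sigma> ` {..<k} = {..<k}" "x \<in> inv \<sigma> ` {..<k} \<longleftrightarrow> \<sigma> x < k"
    if "\<sigma> permutes {..<n}" for \<sigma> x
  proof -
    have p: "inv \<sigma> permutes {..<n}" using that permutes_inv by blast
    show "inv \<sigma> ` {..<k} \<subseteq> {..<n}"
      using permutes_image[OF p] k by (metis image_mono lessThan_subset_iff less_imp_le)
    show "card (inv \<sigma> ` {..<k}) = k" by (simp add: card_image permutes_inj_on[OF p])
    show "\<sigma> ` inv \<sigma> ` {..<k} = {..<k}"
      by (simp add: image_image permutes_inverses(1)[OF that])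
    show "x \<in> inv \<sigma> ` {..<k} \<longleftrightarrow> \<sigma> x < k"
      using permutes_inverses[OF that] by (metis imageE image_eqI lessThan_iff)
  qed
  have nz: "marginal n k (t j) (inv \<sigma> ` {..<k}) \<noteq> 0" if "\<sigma> permutes {..<n}" "t j \<sigma> \<noteq> 0" for \<sigma>
    using pos preimage[OF that(1)] that by blast
  have base: "marginal n k (t j) {..<k} = 0" using pos[of "{..<k}"] zero by auto
  have k_sub: "{..<k} \<subseteq> {..<n}" using k by auto
  show ?thesis
  proof (cases "v < k")
    case True
    have supp: "k \<le> \<sigma> v" if "\<sigma> permutes {..<n}" "t j \<sigma> \<noteq> 0" for \<sigma>
      using same[OF k_sub _ preimage(1,2)[OF that(1)]] nz[OF that] base True preimage(4)[OF that(1)]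
      by (auto simp: not_less[symmetric])
    have "low j k v"
      unfolding low_def
    proof (intro conjI allI impI)
      show "\<exists>\<sigma>. \<sigma> permutes {..<n} \<and> t j \<sigma> \<noteq> 0 \<and> \<sigma> ` I = {..<k}"
        if "I \<subseteq> {..<n}" "card I = k \<and> v \<notin> I" for I
        using same[OF that(1) _ preimage(1,2)[OF \<sigma>0(1)]] nz[OF \<sigma>0(1,3)] pos[of I] that
          preimage(4)[OF \<sigma>0(1), of v] supp[OF \<sigma>0(1,3)] by auto
      have "\<sigma>0 v \<in> insert k {..<k - 1}" using \<sigma>0(2) True by blast
      then show "\<exists>\<sigma>. \<sigma> permutes {..<n} \<and> t j \<sigma> \<noteq> 0 \<and> \<sigma> v = k"
        using supp[OF \<sigma>0(1,3)] \<sigma>0 by auto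
    qed (use supp in blast)
    then show ?thesis using True k by (intro exI[of _ v]) auto
  next
    case False
    have supp: "\<sigma> v < k" if "\<sigma> permutes {..<n}" "t j \<sigma> \<noteq> 0" for \<sigma>
      using same[OF k_sub _ preimage(1,2)[OF that(1)]] nz[OF that] base False preimage(4)[OF that(1)]
      by (auto simp: not_less[symmetric])
    have "high j k v"
      unfolding high_def
    proof (intro conjI allI impI)
      show "\<exists>\<sigma>. \<sigma> permutes {..<n} \<and> t j \<sigma> \<noteq> 0 \<and> \<sigma> ` I = {..<k}"
        if "I \<subseteq> {..<n}" "card I = k \<and> v \<in> I" for I
        using same[OF that(1) _ preimage(1,2)[OF \<sigma>0(1)]] nz[OF \<sigma>0(1,3)] pos[of I] that
          preimage(4)[OF \<sigma>0(1), of v] supp[OF \<sigma>0(1,3)] by auto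
      \<comment> \<open>The values below \<open>k - 1\<close> are already taken on
        \<open>{..<k}\<close>, so only \<open>k - 1\<close> is left for
        \<open>\<sigma>0 v\<close>.\<close>
      have "\<sigma>0 v \<notin> \<sigma>0 ` {..<k}"
        using False inj_image_mem_iff[OF permutes_inj[OF \<sigma>0(1)]] by auto
      then have "\<sigma>0 v \<notin> {..<k - 1}" using \<sigma>0(2) by blast
      then show "\<exists>\<sigma>. \<sigma> permutes {..<n} \<and> t j \<sigma> \<noteq> 0 \<and> Suc (\<sigma> v) = k"
        using supp[OF \<sigma>0(1,3)] \<sigma>0 by (intro exI[of _ \<sigma>0]) auto
    qed (use supp in blast)
    \<comment> \<open>A point beyond \<open>n\<close> would be fixed by \<open>\<sigma>0\<close>,
      contrary to \<open>\<sigma>0 v < k\<close>.\<close>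
    moreover have "v < n"
      using supp[OF \<sigma>0(1,3)] k permutes_not_in[OF \<sigma>0(1), of v] by (cases "v < n") auto
    ultimately show ?thesis by blast
  qed
qed

theorem card_ge_if_separating:
  assumes n: "6 \<le> n"
    and nonneg: "\<And>j \<sigma>. j < K \<Longrightarrow> \<sigma> permutes {..<n} \<Longrightarrow> 0 \<le> t j \<sigma>"
    and sep: "\<And>k. 1 \<le> k \<Longrightarrow> k < n \<Longrightarrow> \<exists>j<K.
      (\<forall>\<sigma>. \<sigma> permutes {..<n} \<longrightarrow> \<sigma> ` {..<k} = {..<k} \<longrightarrow> t j \<sigma> = 0) \<and>
      (\<exists>\<sigma>. \<sigma> permutes {..<n} \<and> \<sigma> ` {..<k} = insert k {..<k - 1} \<and> t j \<sigma> \<noteq> 0)"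
  shows "n * (n - 1) \<le> 4 * K"
proof (rule ccontr)
  assume "\<not> n * (n - 1) \<le> 4 * K"
  then have K: "4 * K < n * (n - 1)" by simp
  define A where "A = {k. 1 \<le> k \<and> k < n \<and> 2 * k \<noteq> n}"
  \<comment> \<open>The Boolean records whether the member is low or high at \<open>(k, v)\<close>;
    by uniqueness a member then serves at most two pairs.\<close>
  have "\<exists>p\<in>{..<K} \<times> UNIV. if snd p then low (fst p) k v else high (fst p) k v"
    if "k \<in> A" "v < n" for k v
  proof -
    obtain j \<sigma>0 where j: "j < K" "\<And>\<sigma>. \<sigma> permutes {..<n} \<Longrightarrow> \<sigma> ` {..<k} = {..<k} \<Longrightarrow> t j \<sigma> = 0"
      "\<sigma>0 permutes {..<n}" "\<sigma>0 ` {..<k} = insert k {..<k - 1}" "t j \<sigma>0 \<noteq> 0"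
      using sep[of k] \<open>k \<in> A\<close> unfolding A_def by blast
    obtain u where u: "u < n" "low j k u \<or> high j k u"
      using low_or_high[OF n K j(1) _ _ _ nonneg[OF j(1)] j(2-5)] \<open>k \<in> A\<close> unfolding A_def by blast
    then obtain l where "l < K" "low l k v \<or> high l k v"
      using ex_translate[OF j(1) u(1) \<open>v < n\<close>] by blast
    then show ?thesis
      by (cases "low l k v") (auto intro: bexI[of _ "(l, True)"] bexI[of _ "(l, False)"])
  qed
  then obtain g where g: "\<And>k v. k \<in> A \<Longrightarrow> v < n \<Longrightarrow> g k v \<in> {..<K} \<times> UNIV"
      "\<And>k v. k \<in> A \<Longrightarrow> v < n \<Longrightarrow>
        if snd (g k v) then low (fst (g k v)) k v else high (fst (g k v)) k v"
    by metis
  have eq: "k = k' \<and> v = v'"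
    if "k \<in> A" "k' \<in> A" "v < n" "v' < n" "g k v = g k' v'" "k \<le> k'" for k k' v v'
  proof -
    have k: "1 \<le> k" "k' < n" using that(1,2) by (auto simp: A_def)
    show ?thesis
    proof (cases "snd (g k v)")
      case True
      then have "low (fst (g k v)) k v" "low (fst (g k v)) k' v'"
        using g(2)[OF that(1,3)] g(2)[OF that(2,4)] that(5) by auto
      then show ?thesis by (rule low_unique) (use k that(3,4,6) in auto)
    next
      case False
      then have "high (fst (g k v)) k v" "high (fst (g k v)) k' v'"
        using g(2)[OF that(1,3)] g(2)[OF that(2,4)] that(5) by auto
      then show ?thesis by (rule high_unique) (use k that(3,4,6) in auto)
    qed
  qed
  have "inj_on (\<lambda>(k, v). g k v) (A \<times> {..<n})"
  proof (rule inj_onI)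
    fix p q assume pq: "p \<in> A \<times> {..<n}" "q \<in> A \<times> {..<n}"
      "(\<lambda>(k, v). g k v) p = (\<lambda>(k, v). g k v) q"
    obtain k v k' v' where p: "p = (k, v)" "q = (k', v')" by fastforce
    have *: "k \<in> A" "k' \<in> A" "v < n" "v' < n" "g k v = g k' v'" using pq unfolding p by auto
    show "p = q"
      using eq[OF *] eq[OF *(2,1,4,3) *(5)[symmetric]] unfolding p by (metis nat_le_linear)
  qed
  moreover have "(\<lambda>(k, v). g k v) ` (A \<times> {..<n}) \<subseteq> {..<K} \<times> UNIV"
    using g(1) by (auto simp del: mem_Times_iff) (metis SigmaD1 lessThan_iff)
  ultimately have "card (A \<times> {..<n}) \<le> card ({..<K} \<times> (UNIV :: bool set))"
    by (intro card_inj_on_le) auto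
  then have AK: "card A * n \<le> 2 * K" by (simp add: card_cartesian_product)
  have "card ({1..<n} - {n div 2}) \<le> card A"
    by (intro card_mono) (auto simp: A_def)
  then have "n - 2 \<le> card A" using n by (simp add: card_Diff_singleton_if split: if_splits)
  then have "(n - 2) * n \<le> 2 * K" using AK by (meson le_trans mult_le_mono1)
  moreover have "n * (n - 1) \<le> 2 * ((n - 2) * n)"
    using n mult_le_mono2[of "n - 1" "2 * (n - 2)" n] by (simp only: ac_simps)
  ultimately show False using K by simp
qed

end

subsection \<open>The permutahedron\<close>

text \<open>Here \<open>\<sigma>\<close> is the inverse of the \<open>\<zeta>\<close> in
  \<open>permutahedron_vertices\<close>, so permuting coordinates becomes right translation of
  \<open>\<sigma>\<close>.\<close>

definition vert :: "nat \<Rightarrow> (nat \<Rightarrow> nat) \<Rightarrow> nat \<Rightarrow> real" where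
  "vert n \<sigma> = (\<lambda>v. if v < n then real (\<sigma> v) + 1 else 0)"

lemma permutahedron_vertices_eq:
  "permutahedron_vertices n = vert n ` {\<sigma>. \<sigma> permutes {..<n}}"
proof -
  have "vert n \<sigma> \<in> permutahedron_vertices n" if "\<sigma> permutes {..<n}" for \<sigma>
    unfolding permutahedron_vertices_def vert_def
    using permutes_inv[OF that] permutes_inv_inv[OF that]
    by (intro CollectI exI[of _ "inv \<sigma>"]) (simp cong: if_cong)
  then show ?thesis
    by (auto simp: permutahedron_vertices_def vert_def intro: permutes_inv)
qed

lemma perm_act_vert:
  assumes "\<pi> permutes {..<n}"
  shows "perm_act \<pi> (vert n \<sigma>) = vert n (\<sigma> \<circ> inv \<pi>)"
proof
  fix v
  have "inv \<pi> v < n \<longleftrightarrow> v < n"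
    using permutes_in_image[OF permutes_inv[OF assms], of v] by simp
  then show "perm_act \<pi> (vert n \<sigma>) v = vert n (\<sigma> \<circ> inv \<pi>) v"
    by (simp add: perm_act_def vert_def)
qed

lemma vert_in_permutahedron:
  assumes "\<sigma> permutes {..<n}"
  shows "vert n \<sigma> \<in> permutahedron n"
proof -
  have "vert n \<sigma> \<in> permutahedron_vertices n"
    using assms by (auto simp: permutahedron_vertices_eq)
  moreover have "finite (permutahedron_vertices n)"
    using finite_permutations by (auto simp: permutahedron_vertices_eq)
  ultimately show ?thesis
    unfolding permutahedron_def conv_hull_fin_def
    by (intro CollectI exI[of _ "\<lambda>x. if x = vert n \<sigma> then 1 else 0"])
      (simp add: if_distrib[of "\<lambda>c. c * _"] cong: if_cong)
qed

text \<open>Induction removing the maximum, which is at least \<open>card S - 1\<close>.\<close>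

lemma sum_lessThan_card_le:
  fixes S :: "nat set"
  assumes "finite S"
  shows "\<Sum>{..<card S} \<le> \<Sum>S"
  using assms
proof (induction "card S" arbitrary: S)
  case (Suc m)
  then have "S \<noteq> {}" by auto
  let ?M = "Max S"
  have M: "?M \<in> S" using Suc \<open>S \<noteq> {}\<close> by simp
  have "S \<subseteq> {..?M}" using Suc by auto
  then have "card S \<le> Suc ?M" using card_mono[of "{..?M}" S] by simp
  moreover have "\<Sum>{..<m} \<le> \<Sum>(S - {?M})"
  proof -
    have "m = card (S - {?M})" using Suc.hyps(2) Suc.prems M by simp
    from Suc.hyps(1)[OF this] this show ?thesis using Suc.prems by simp
  qed
  moreover have "\<Sum>S = ?M + \<Sum>(S - {?M})" using Suc.prems M by (simp add: sum.remove)
  moreover have "\<Sum>{..<card S} = m + \<Sum>{..<m}"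
    unfolding Suc.hyps(2)[symmetric] by (simp add: lessThan_Suc)
  ultimately show ?case using Suc.hyps(2) by linarith
qed simp

lemma sum_vert:
  assumes "\<sigma> permutes {..<n}" "k \<le> n"
  shows "(\<Sum>v<k. vert n \<sigma> v) = real (\<Sum>(\<sigma> ` {..<k})) + real k"
proof -
  have "(\<Sum>v<k. vert n \<sigma> v) = (\<Sum>v<k. real (\<sigma> v) + 1)"
    using assms(2) by (intro sum.cong) (auto simp: vert_def)
  then show ?thesis
    using permutes_inj_on[OF assms(1)] by (simp add: sum.distrib sum.reindex)
qed

lemma permutahedron_facet_inequality:
  assumes "x \<in> permutahedron n" "k \<le> n"
  shows "real (\<Sum>{..<k}) + real k \<le> (\<Sum>v<k. x v)"
proof -
  let ?X = "permutahedron_vertices n"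
  let ?m = "real (\<Sum>{..<k}) + real k"
  obtain c where c: "\<And>u. u \<in> ?X \<Longrightarrow> 0 \<le> c u" "sum c ?X = 1" "\<And>i. x i = (\<Sum>u\<in>?X. c u * u i)"
    using assms(1) unfolding permutahedron_def conv_hull_fin_def by blast
  have "?m \<le> (\<Sum>v<k. u v)" if u: "u \<in> ?X" for u
  proof -
    obtain \<sigma> where \<sigma>: "\<sigma> permutes {..<n}" "u = vert n \<sigma>"
      using u by (auto simp: permutahedron_vertices_eq)
    have "card (\<sigma> ` {..<k}) = k" by (simp add: card_image permutes_inj_on[OF \<sigma>(1)])
    then have "real (\<Sum>{..<k}) \<le> real (\<Sum>(\<sigma> ` {..<k}))"
      using sum_lessThan_card_le[of "\<sigma> ` {..<k}"] by (simp only: of_nat_le_iff finite_imageI finite_lessThan)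
    then show ?thesis
      using sum_vert[OF \<sigma>(1) assms(2)] \<sigma>(2) by simp
  qed
  then have "(\<Sum>u\<in>?X. c u * ?m) \<le> (\<Sum>u\<in>?X. c u * (\<Sum>v<k. u v))"
    using c(1) by (intro sum_mono mult_left_mono) auto
  also have "\<dots> = (\<Sum>v<k. x v)"
    by (simp add: c(3) sum_distrib_left sum.swap[of _ ?X])
  finally show ?thesis using c(2) by (simp flip: sum_distrib_right)
qed

subsection \<open>Averaging\<close>

definition average :: "'a set \<Rightarrow> ('a \<Rightarrow> nat \<Rightarrow> real) \<Rightarrow> nat \<Rightarrow> real" where
  "average N f = (\<lambda>j. (\<Sum>x\<in>N. f x j) / real (card N))"

lemma sum_mult_average:
  "(\<Sum>j\<in>J. a j * average N f j) = (\<Sum>x\<in>N. \<Sum>j\<in>J. a j * f x j) / real (card N)"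
  by (simp add: average_def sum_distrib_left sum_divide_distrib sum.swap[of _ N])

lemma lin_map_average:
  assumes "finite N" "N \<noteq> {}" "\<And>x. x \<in> N \<Longrightarrow> lin_map P n d (f x) = z"
  shows "lin_map P n d (average N f) = z"
proof
  fix i
  have "(\<Sum>j<d. P i j * f x j) = z i" if "x \<in> N" "i < n" for x
    using assms(3)[OF that(1)] that(2) by (auto simp: lin_map_def)
  moreover have "z i = 0" if "\<not> i < n"
  proof -
    obtain x where "x \<in> N" using assms(2) by blast
    then show ?thesis using fun_cong[OF assms(3), of x i] that by (simp add: lin_map_def)
  qed
  ultimately show "lin_map P n d (average N f) i = z i"
    using assms(1,2) by (simp add: lin_map_def sum_mult_average)
qed

lemma average_in_ef_solutions:
  assumes "finite N" "N \<noteq> {}" "\<And>x. x \<in> N \<Longrightarrow> f x \<in> ef_solutions d k1 A1 b1 k2 A2 b2"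
  shows "average N f \<in> ef_solutions d k1 A1 b1 k2 A2 b2"
proof -
  have pos: "0 < real (card N)" using assms(1,2) by (simp add: card_gt_0_iff)
  have "average N f \<in> rvec d"
    using assms(3) by (simp add: average_def rvec_def ef_solutions_def)
  moreover have "(\<Sum>j<d. A1 i j * average N f j) = b1 i" if "i < k1" for i
    using assms(3) that pos by (simp add: sum_mult_average ef_solutions_def)
  moreover have "(\<Sum>j<d. A2 i j * average N f j) \<le> b2 i" if "i < k2" for i
  proof -
    have "(\<Sum>x\<in>N. \<Sum>j<d. A2 i j * f x j) \<le> (\<Sum>x\<in>N. b2 i)"
      using assms(3) that by (intro sum_mono) (simp add: ef_solutions_def)
    then show ?thesis using pos by (simp add: sum_mult_average pos_divide_le_eq mult.commute)
  qed
  ultimately show ?thesis by (simp add: ef_solutions_def)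
qed

lemma ex_small_multiplier:
  fixes a b :: "'a \<Rightarrow> real"
  assumes "finite J" "\<And>j. j \<in> J \<Longrightarrow> 0 < a j"
  shows "\<exists>\<epsilon>>0. \<forall>j\<in>J. \<epsilon> * b j \<le> a j"
  using assms
proof (induction J rule: finite_induct)
  case empty
  then show ?case by (auto intro: exI[of _ 1])
next
  case (insert j J)
  then obtain \<epsilon> where \<epsilon>: "0 < \<epsilon>" "\<forall>j\<in>J. \<epsilon> * b j \<le> a j" by auto
  \<comment> \<open>Adding 1 keeps the denominator positive when \<open>b j = 0\<close>.\<close>
  define \<delta> where "\<delta> = min \<epsilon> (a j / (\<bar>b j\<bar> + 1))"
  have \<delta>: "0 < \<delta>" "\<delta> \<le> \<epsilon>" "\<delta> \<le> a j / (\<bar>b j\<bar> + 1)"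
    using \<epsilon>(1) insert.prems[of j] by (auto simp: \<delta>_def)
  have "\<delta> * b l \<le> a l" if "l \<in> J" for l
  proof (cases "0 \<le> b l")
    case True
    then have "\<delta> * b l \<le> \<epsilon> * b l" using \<delta>(2) by (rule mult_right_mono[rotated])
    then show ?thesis using \<epsilon>(2) that by fastforce
  next
    case False
    then have "\<delta> * b l \<le> 0" using \<delta>(1) by (simp add: mult_le_0_iff)
    then show ?thesis using insert.prems[of l] that by simp
  qed
  moreover have "\<delta> * b j \<le> a j"
  proof -
    have "\<delta> * b j \<le> \<delta> * (\<bar>b j\<bar> + 1)" using \<delta>(1) by (intro mult_left_mono) auto
    also have "\<dots> \<le> a j" using \<delta>(3) by (simp add: pos_le_divide_eq add_nonneg_pos)
    finally show ?thesis .
  qed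
  ultimately show ?case using \<delta>(1) by auto
qed

subsection \<open>The equivariant section\<close>

lemma perm_act_comp:
  assumes "\<pi> permutes A" "\<pi>' permutes B"
  shows "perm_act (\<pi>' \<circ> \<pi>) x = perm_act \<pi>' (perm_act \<pi> x)"
  using o_inv_distrib[OF permutes_bij[OF assms(2)] permutes_bij[OF assms(1)]]
  by (simp add: perm_act_def)

lemma perm_act_rvec:
  assumes "\<kappa> permutes {..<d}" "y \<in> rvec d"
  shows "perm_act \<kappa> y \<in> rvec d"
  using assms permutes_not_in[OF permutes_inv[OF assms(1)]] by (simp add: rvec_def perm_act_def)

text \<open>Hiding \<open>\<rho>\<close> leaves a condition on \<open>\<kappa>\<close> alone, so
  that lifts become plain column permutations.\<close>

definition rows_invariant ::
  "nat \<Rightarrow> nat \<Rightarrow> (nat \<Rightarrow> nat \<Rightarrow> real) \<Rightarrow> (nat \<Rightarrow> real) \<Rightarrow> (nat \<Rightarrow> nat) \<Rightarrow> bool" where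
  "rows_invariant d k A b \<kappa> \<longleftrightarrow> (\<exists>\<rho>. \<rho> permutes {..<k} \<and>
    (\<forall>i<k. \<forall>j<d. A (\<rho> i) (\<kappa> j) = A i j) \<and> (\<forall>i<k. b (\<rho> i) = b i))"

lemma rows_invariant_comp:
  assumes "rows_invariant d k A b \<kappa>" "rows_invariant d k A b \<kappa>'" "\<kappa> permutes {..<d}"
  shows "rows_invariant d k A b (\<kappa>' \<circ> \<kappa>)"
proof -
  obtain \<rho> where \<rho>: "\<rho> permutes {..<k}" "\<And>i j. i < k \<Longrightarrow> j < d \<Longrightarrow> A (\<rho> i) (\<kappa> j) = A i j"
      "\<And>i. i < k \<Longrightarrow> b (\<rho> i) = b i"
    using assms(1) unfolding rows_invariant_def by blast
  obtain \<rho>' where \<rho>': "\<rho>' permutes {..<k}" "\<And>i j. i < k \<Longrightarrow> j < d \<Longrightarrow> A (\<rho>' i) (\<kappa>' j) = A i j"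
      "\<And>i. i < k \<Longrightarrow> b (\<rho>' i) = b i"
    using assms(2) unfolding rows_invariant_def by blast
  have "\<rho> i < k" if "i < k" for i using permutes_in_image[OF \<rho>(1), of i] that by simp
  moreover have "\<kappa> j < d" if "j < d" for j using permutes_in_image[OF assms(3), of j] that by simp
  ultimately show ?thesis
    unfolding rows_invariant_def using \<rho> \<rho>'
    by (intro exI[of _ "\<rho>' \<circ> \<rho>"]) (simp add: permutes_compose)
qed

lemma row_perm_act:
  assumes "\<kappa> permutes {..<d}" "rows_invariant d k A b \<kappa>" "i < k"
  shows "\<exists>i'<k. b i' = b i \<and> (\<forall>y. (\<Sum>j<d. A i j * perm_act \<kappa> y j) = (\<Sum>j<d. A i' j * y j))"
proof -
  obtain \<rho> where \<rho>: "\<rho> permutes {..<k}" "\<And>i j. i < k \<Longrightarrow> j < d \<Longrightarrow> A (\<rho> i) (\<kappa> j) = A i j"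
      "\<And>i. i < k \<Longrightarrow> b (\<rho> i) = b i"
    using assms(2) unfolding rows_invariant_def by blast
  define i' where "i' = inv \<rho> i"
  have i': "i' < k" "\<rho> i' = i"
    using permutes_in_image[OF permutes_inv[OF \<rho>(1)], of i] assms(3) permutes_inverses(1)[OF \<rho>(1)]
    by (auto simp: i'_def)
  have "(\<Sum>j<d. A i j * perm_act \<kappa> y j) = (\<Sum>j<d. A i (\<kappa> j) * perm_act \<kappa> y (\<kappa> j))" for y
    using sum.permute[OF assms(1), of "\<lambda>j. A i j * perm_act \<kappa> y j"] by (simp add: comp_def)
  also have "\<dots> y = (\<Sum>j<d. A i' j * y j)" for y
    using \<rho>(2)[OF i'(1)] i'(2) permutes_inverses(2)[OF assms(1)]
    by (intro sum.cong) (auto simp: perm_act_def)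
  finally show ?thesis using \<rho>(3)[OF i'(1)] i' by auto
qed

locale symmetric_formulation =
  fixes n d :: nat and P :: "nat \<Rightarrow> nat \<Rightarrow> real"
    and k1 :: nat and A1 :: "nat \<Rightarrow> nat \<Rightarrow> real" and b1 :: "nat \<Rightarrow> real"
    and k2 :: nat and A2 :: "nat \<Rightarrow> nat \<Rightarrow> real" and b2 :: "nat \<Rightarrow> real"
  assumes ext: "is_ext_form_perm n d P k1 A1 b1 k2 A2 b2"
    and sym: "symmetric_ext_form_perm n d P k1 A1 b1 k2 A2 b2"
begin

abbreviation "Q \<equiv> ef_solutions d k1 A1 b1 k2 A2 b2"
abbreviation "p \<equiv> lin_map P n d"

text \<open>A choice of one \<open>\<kappa>\<close> for each \<open>\<pi>\<close> need not respect
  composition; the sets of all admissible \<open>\<kappa>\<close> do.\<close>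

definition lifts :: "(nat \<Rightarrow> nat) \<Rightarrow> (nat \<Rightarrow> nat) set" where
  "lifts \<pi> = {\<kappa>. \<kappa> permutes {..<d} \<and>
    (\<forall>y\<in>rvec d. p y \<in> permutahedron_vertices n \<longrightarrow> p (perm_act \<kappa> y) = perm_act \<pi> (p y)) \<and>
    rows_invariant d k1 A1 b1 \<kappa> \<and> rows_invariant d k2 A2 b2 \<kappa>}"

lemma finite_lifts: "finite (lifts \<pi>)"
  by (rule finite_subset[OF _ finite_permutations[of "{..<d}"]]) (auto simp: lifts_def)

lemma lifts_nonempty: "\<pi> permutes {..<n} \<Longrightarrow> lifts \<pi> \<noteq> {}"
  using sym unfolding symmetric_ext_form_perm_def lifts_def rows_invariant_def by blast

text \<open>Equivariance is given only over vertices, but \<open>\<kappa>\<close> maps points over a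
  vertex to points over a vertex, where \<open>\<kappa>'\<close> applies.\<close>

lemma lifts_comp:
  assumes "\<pi> permutes {..<n}" "\<pi>' permutes {..<n}" "\<kappa> \<in> lifts \<pi>" "\<kappa>' \<in> lifts \<pi>'"
  shows "\<kappa>' \<circ> \<kappa> \<in> lifts (\<pi>' \<circ> \<pi>)"
proof -
  have \<kappa>: "\<kappa> permutes {..<d}" "\<kappa>' permutes {..<d}" using assms by (auto simp: lifts_def)
  have "p (perm_act (\<kappa>' \<circ> \<kappa>) y) = perm_act (\<pi>' \<circ> \<pi>) (p y)"
    if y: "y \<in> rvec d" "p y \<in> permutahedron_vertices n" for y
  proof -
    have 1: "p (perm_act \<kappa> y) = perm_act \<pi> (p y)" using assms(3) y by (simp add: lifts_def)
    obtain \<sigma> where "\<sigma> permutes {..<n}" "p y = vert n \<sigma>"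
      using y(2) by (auto simp: permutahedron_vertices_eq)
    then have "p (perm_act \<kappa> y) \<in> permutahedron_vertices n"
      using 1 perm_act_vert[OF assms(1)] permutes_compose[OF permutes_inv[OF assms(1)]]
      by (simp add: permutahedron_vertices_eq)
    then have "p (perm_act \<kappa>' (perm_act \<kappa> y)) = perm_act \<pi>' (p (perm_act \<kappa> y))"
      using assms(4) perm_act_rvec[OF \<kappa>(1) y(1)] by (simp add: lifts_def)
    then show ?thesis
      using 1 perm_act_comp[OF \<kappa>] perm_act_comp[OF assms(1,2)] by simp
  qed
  then show ?thesis
    using assms(3,4) \<kappa> by (auto simp: lifts_def permutes_compose rows_invariant_comp)
qed

text \<open>Surjectivity follows by counting: composing with a lift of \<open>inv \<pi>'\<close>
  gives the reverse inequality of cardinalities.\<close>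

lemma lifts_comp_image:
  assumes "\<pi> permutes {..<n}" "\<pi>' permutes {..<n}" "\<kappa>' \<in> lifts \<pi>'"
  shows "(\<lambda>\<kappa>. \<kappa>' \<circ> \<kappa>) ` lifts \<pi> = lifts (\<pi>' \<circ> \<pi>)" "inj_on (\<lambda>\<kappa>. \<kappa>' \<circ> \<kappa>) (lifts \<pi>)"
proof -
  have inj: "inj_on (\<lambda>\<kappa>. \<tau> \<circ> \<kappa>) L" if "\<tau> \<in> lifts \<alpha>" for \<tau> \<alpha> and L :: "(nat \<Rightarrow> nat) set"
    using that permutes_inj[of \<tau>] by (auto simp: lifts_def inj_on_def fun_eq_iff dest: injD)
  have le: "card (lifts \<beta>) \<le> card (lifts (\<alpha> \<circ> \<beta>))"
    if \<alpha>: "\<alpha> permutes {..<n}" "\<beta> permutes {..<n}" for \<alpha> \<beta>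
  proof -
    obtain \<tau> where \<tau>: "\<tau> \<in> lifts \<alpha>" using lifts_nonempty[OF \<alpha>(1)] by blast
    show ?thesis
      by (rule card_inj_on_le[OF inj[OF \<tau>]]) (use lifts_comp \<alpha> \<tau> finite_lifts in auto)
  qed
  have "inv \<pi>' \<circ> (\<pi>' \<circ> \<pi>) = \<pi>" using permutes_inverses(2)[OF assms(2)] by (simp add: fun_eq_iff)
  then have "card (lifts (\<pi>' \<circ> \<pi>)) \<le> card (lifts \<pi>)"
    using le[OF permutes_inv[OF assms(2)] permutes_compose[OF assms(1,2)]] by simp
  moreover have "card ((\<lambda>\<kappa>. \<kappa>' \<circ> \<kappa>) ` lifts \<pi>) = card (lifts \<pi>)"
    by (rule card_image[OF inj[OF assms(3)]])
  moreover have "(\<lambda>\<kappa>. \<kappa>' \<circ> \<kappa>) ` lifts \<pi> \<subseteq> lifts (\<pi>' \<circ> \<pi>)"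
    using lifts_comp assms by auto
  ultimately show "(\<lambda>\<kappa>. \<kappa>' \<circ> \<kappa>) ` lifts \<pi> = lifts (\<pi>' \<circ> \<pi>)"
    by (intro card_seteq finite_lifts) auto
  show "inj_on (\<lambda>\<kappa>. \<kappa>' \<circ> \<kappa>) (lifts \<pi>)" by (rule inj[OF assms(3)])
qed

lemma perm_act_Q:
  assumes "\<kappa> \<in> lifts \<pi>" "y \<in> Q"
  shows "perm_act \<kappa> y \<in> Q"
proof -
  have \<kappa>: "\<kappa> permutes {..<d}" "rows_invariant d k1 A1 b1 \<kappa>" "rows_invariant d k2 A2 b2 \<kappa>"
    using assms(1) by (auto simp: lifts_def)
  have "(\<Sum>j<d. A1 i j * perm_act \<kappa> y j) = b1 i" if "i < k1" for i
    using row_perm_act[OF \<kappa>(1,2) that] assms(2) by (auto simp: ef_solutions_def)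
  moreover have "(\<Sum>j<d. A2 i j * perm_act \<kappa> y j) \<le> b2 i" if "i < k2" for i
    using row_perm_act[OF \<kappa>(1,3) that] assms(2) by (auto simp: ef_solutions_def)
  ultimately show ?thesis
    using assms(2) perm_act_rvec[OF \<kappa>(1)] by (simp add: ef_solutions_def)
qed

text \<open>One preimage \<open>y\<close> of \<open>vert n id\<close> is fixed, and its images under
  all lifts of \<open>inv \<sigma>\<close> are averaged, since \<open>inv \<sigma>\<close> carries
  \<open>vert n id\<close> to \<open>vert n \<sigma>\<close>. Composing with \<open>\<kappa>\<close>
  maps one set of lifts bijectively onto the other, which gives equivariance.\<close>

lemma ex_equivariant_section:
  "\<exists>s. (\<forall>\<sigma>. \<sigma> permutes {..<n} \<longrightarrow> s \<sigma> \<in> Q \<and> p (s \<sigma>) = vert n \<sigma>) \<and>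
    (\<forall>\<sigma> \<pi> \<kappa>. \<sigma> permutes {..<n} \<longrightarrow> \<pi> permutes {..<n} \<longrightarrow> \<kappa> \<in> lifts \<pi> \<longrightarrow>
      s (\<sigma> \<circ> inv \<pi>) = perm_act \<kappa> (s \<sigma>))"
proof -
  have "vert n id \<in> permutahedron n" by (rule vert_in_permutahedron[OF permutes_id])
  then obtain y where y: "y \<in> Q" "p y = vert n id"
    using ext unfolding is_ext_form_perm_def by force
  have y': "y \<in> rvec d" "p y \<in> permutahedron_vertices n"
    using y permutes_id by (auto simp: ef_solutions_def permutahedron_vertices_eq)
  define s where "s \<sigma> = average (lifts (inv \<sigma>)) (\<lambda>\<kappa>. perm_act \<kappa> y)" for \<sigma>
  have "s \<sigma> \<in> Q \<and> p (s \<sigma>) = vert n \<sigma>" if "\<sigma> permutes {..<n}" for \<sigma>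
  proof
    note inv = permutes_inv[OF that]
    show "s \<sigma> \<in> Q" unfolding s_def
      by (rule average_in_ef_solutions[OF finite_lifts lifts_nonempty[OF inv]])
        (rule perm_act_Q[OF _ y(1)])
    show "p (s \<sigma>) = vert n \<sigma>" unfolding s_def
    proof (rule lin_map_average[OF finite_lifts lifts_nonempty[OF inv]])
      fix \<kappa> assume "\<kappa> \<in> lifts (inv \<sigma>)"
      then have "p (perm_act \<kappa> y) = perm_act (inv \<sigma>) (vert n id)"
        using y' y(2) by (simp add: lifts_def)
      then show "p (perm_act \<kappa> y) = vert n \<sigma>"
        by (simp add: perm_act_vert[OF inv] permutes_inv_inv[OF that])
    qed
  qed
  moreover have "s (\<sigma> \<circ> inv \<pi>) = perm_act \<kappa> (s \<sigma>)"
    if "\<sigma> permutes {..<n}" "\<pi> permutes {..<n}" "\<kappa> \<in> lifts \<pi>" for \<sigma> \<pi> \<kappa>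
  proof
    fix j
    have "inv (\<sigma> \<circ> inv \<pi>) = \<pi> \<circ> inv \<sigma>"
      using o_inv_distrib[OF permutes_bij[OF that(1)] permutes_bij[OF permutes_inv[OF that(2)]]]
        permutes_inv_inv[OF that(2)] by simp
    then have *: "lifts (inv (\<sigma> \<circ> inv \<pi>)) = (\<lambda>\<kappa>'. \<kappa> \<circ> \<kappa>') ` lifts (inv \<sigma>)"
      using lifts_comp_image(1)[OF permutes_inv[OF that(1)] that(2,3)] by simp
    note inj = lifts_comp_image(2)[OF permutes_inv[OF that(1)] that(2,3)]
    have "perm_act (\<kappa> \<circ> \<kappa>') y j = perm_act \<kappa>' y (inv \<kappa> j)" if "\<kappa>' \<in> lifts (inv \<sigma>)" for \<kappa>'
      using perm_act_comp[of \<kappa>' "{..<d}" \<kappa> "{..<d}" y] that \<open>\<kappa> \<in> lifts \<pi>\<close>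
      by (simp add: lifts_def) (simp add: perm_act_def)
    then show "s (\<sigma> \<circ> inv \<pi>) j = perm_act \<kappa> (s \<sigma>) j"
      unfolding s_def * average_def using inj
      by (simp add: sum.reindex card_image perm_act_def[of \<kappa> "\<lambda>j. _ j"])
  qed
  ultimately show ?thesis by blast
qed

text \<open>If every inequality tight on the whole face were also tight at a vertex \<open>\<sigma>\<close> beyond it, one
  could move from the barycentre of the lifted face slightly away from \<open>s \<sigma>\<close> without leaving the
  formulation, and so violate the facet inequality.\<close>

lemma ex_separating_row:
  assumes s: "\<And>\<sigma>. \<sigma> permutes {..<n} \<Longrightarrow> s \<sigma> \<in> Q" "\<And>\<sigma>. \<sigma> permutes {..<n} \<Longrightarrow> p (s \<sigma>) = vert n \<sigma>"
    and k: "1 \<le> k" "k < n"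
  defines "t \<equiv> \<lambda>i \<sigma>. b2 i - (\<Sum>j<d. A2 i j * s \<sigma> j)"
  shows "\<exists>i<k2. (\<forall>\<sigma>. \<sigma> permutes {..<n} \<longrightarrow> \<sigma> ` {..<k} = {..<k} \<longrightarrow> t i \<sigma> = 0) \<and>
    (\<exists>\<sigma>. \<sigma> permutes {..<n} \<and> \<sigma> ` {..<k} = insert k {..<k - 1} \<and> t i \<sigma> \<noteq> 0)"
proof (rule ccontr)
  assume neg: "\<not> ?thesis"
  define F where "F = {\<sigma>. \<sigma> permutes {..<n} \<and> \<sigma> ` {..<k} = {..<k}}"
  \<comment> \<open>The swap of \<open>k - 1\<close> and \<open>k\<close> is a vertex of the layer
    next to the face: its first \<open>k\<close> coordinates sum to \<open>m + 1\<close>.\<close>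
  define \<tau> where "\<tau> = transpose (k - 1) k"
  define c where "c = average F s"
  define m where "m = real (\<Sum>{..<k}) + real k"
  have \<tau>: "\<tau> permutes {..<n}" using k unfolding \<tau>_def by (intro permutes_swap_id) auto
  have split: "{..<k} = insert (k - 1) {..<k - 1}" using k by auto
  have "\<tau> ` {..<k - 1} = {..<k - 1}"
    by (intro image_cong[THEN trans, OF refl _ image_ident]) (auto simp: \<tau>_def transpose_def)
  then have \<tau>_image: "\<tau> ` {..<k} = insert k {..<k - 1}"
    by (subst split) (simp add: \<tau>_def)
  have tight: "t i \<tau> = 0" if "i < k2" "\<And>\<sigma>. \<sigma> \<in> F \<Longrightarrow> t i \<sigma> = 0" for i
    using neg that \<tau> \<tau>_image by (auto simp: F_def)
  have "id \<in> F" by (simp add: F_def permutes_id)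
  then have F: "finite F" "F \<noteq> {}" "\<And>\<sigma>. \<sigma> \<in> F \<Longrightarrow> \<sigma> permutes {..<n}"
    by (simp add: F_def, blast, simp add: F_def)
  then have cardF: "0 < real (card F)" by (simp add: card_gt_0_iff)
  have c: "c \<in> Q" unfolding c_def using F s(1) by (intro average_in_ef_solutions) auto
  define g where "g i = b2 i - (\<Sum>j<d. A2 i j * c j)" for i
  have g_nonneg: "0 \<le> g i" if "i < k2" for i using c that by (simp add: g_def ef_solutions_def)
  have t_nonneg: "0 \<le> t i \<sigma>" if "i < k2" "\<sigma> permutes {..<n}" for i \<sigma>
    using s(1)[OF that(2)] that(1) by (simp add: t_def ef_solutions_def)
  have g_eq: "g i = (\<Sum>\<sigma>\<in>F. t i \<sigma>) / real (card F)" for i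
    unfolding g_def t_def c_def sum_mult_average sum_subtractf diff_divide_distrib
    using cardF by simp
  obtain \<epsilon> where \<epsilon>: "0 < \<epsilon>" "\<forall>i\<in>{i. i < k2 \<and> 0 < g i}. \<epsilon> * t i \<tau> \<le> g i"
  proof -
    have "finite {i. i < k2 \<and> 0 < g i}" by simp
    from ex_small_multiplier[OF this, of g "\<lambda>i. t i \<tau>"] show ?thesis using that by blast
  qed
  define y where "y j = (1 + \<epsilon>) * c j - \<epsilon> * s \<tau> j" for j
  have row_y: "(\<Sum>j<d. a j * y j) = (1 + \<epsilon>) * (\<Sum>j<d. a j * c j) - \<epsilon> * (\<Sum>j<d. a j * s \<tau> j)" for a
    by (simp add: y_def sum_distrib_left algebra_simps sum.distrib sum_subtractf)
  have "y \<in> Q"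
  proof -
    have "y \<in> rvec d" using c s(1)[OF \<tau>] by (simp add: y_def rvec_def ef_solutions_def)
    moreover have "(\<Sum>j<d. A1 i j * y j) = b1 i" if "i < k1" for i
      using c s(1)[OF \<tau>] that unfolding row_y by (simp add: ef_solutions_def algebra_simps)
    moreover have "(\<Sum>j<d. A2 i j * y j) \<le> b2 i" if i: "i < k2" for i
    proof -
      have "b2 i - (\<Sum>j<d. A2 i j * y j) = g i + \<epsilon> * g i - \<epsilon> * t i \<tau>"
        unfolding row_y by (simp add: g_def t_def algebra_simps)
      moreover have "\<epsilon> * t i \<tau> \<le> g i"
      proof (cases "g i = 0")
        case True
        then have "(\<Sum>\<sigma>\<in>F. t i \<sigma>) = 0" using g_eq[of i] cardF by simp
        then have "t i \<tau> = 0"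
          using tight[OF i] F t_nonneg[OF i] by (simp add: sum_nonneg_eq_0_iff)
        then show ?thesis using True by simp
      next
        case False
        then show ?thesis using \<epsilon>(2) g_nonneg[OF i] i by simp
      qed
      moreover have "0 \<le> \<epsilon> * g i" using \<epsilon>(1) g_nonneg[OF i] by simp
      ultimately show ?thesis by linarith
    qed
    ultimately show ?thesis by (simp add: ef_solutions_def)
  qed
  then have "p y \<in> permutahedron n" using ext by (auto simp: is_ext_form_perm_def)
  then have "m \<le> (\<Sum>v<k. p y v)"
    using permutahedron_facet_inequality k unfolding m_def by simp
  also have "\<dots> = (1 + \<epsilon>) * (\<Sum>v<k. p c v) - \<epsilon> * (\<Sum>v<k. p (s \<tau>) v)"
    using k by (simp add: lin_map_def row_y sum_subtractf sum_distrib_left)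
  also have "(\<Sum>v<k. p (s \<tau>) v) = m + 1"
  proof -
    have "\<Sum>{..<k} + 1 = \<Sum>(insert k {..<k - 1})" using k by (subst split) simp
    then have "real (\<Sum>(\<tau> ` {..<k})) = real (\<Sum>{..<k}) + 1"
      unfolding \<tau>_image by (metis of_nat_add of_nat_1)
    then show ?thesis
      using sum_vert[OF \<tau>, of k] k unfolding s(2)[OF \<tau>] m_def by linarith
  qed
  also have "(\<Sum>v<k. p c v) = m"
  proof -
    have "(\<Sum>v<k. p c v) = (\<Sum>\<sigma>\<in>F. \<Sum>v<k. p (s \<sigma>) v) / real (card F)"
      using k by (simp add: lin_map_def c_def sum_mult_average sum.swap[of _ F] flip: sum_divide_distrib)
    moreover have "(\<Sum>v<k. p (s \<sigma>) v) = m" if "\<sigma> \<in> F" for \<sigma>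
      using that sum_vert[of \<sigma> n k] k s(2) by (simp add: F_def m_def)
    ultimately show ?thesis using cardF by simp
  qed
  \<comment> \<open>The chain amounts to \<open>m \<le> m - \<epsilon>\<close>.\<close>
  finally show False using \<epsilon>(1) by (simp add: algebra_simps)
qed

lemma number_of_inequalities_ge:
  assumes "6 \<le> n"
  shows "n * (n - 1) \<le> 4 * k2"
proof -
  obtain s where s: "\<And>\<sigma>. \<sigma> permutes {..<n} \<Longrightarrow> s \<sigma> \<in> Q"
      "\<And>\<sigma>. \<sigma> permutes {..<n} \<Longrightarrow> p (s \<sigma>) = vert n \<sigma>"
      "\<And>\<sigma> \<pi> \<kappa>. \<sigma> permutes {..<n} \<Longrightarrow> \<pi> permutes {..<n} \<Longrightarrow> \<kappa> \<in> lifts \<pi> \<Longrightarrow>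
        s (\<sigma> \<circ> inv \<pi>) = perm_act \<kappa> (s \<sigma>)"
    using ex_equivariant_section by blast
  define t where "t i \<sigma> = b2 i - (\<Sum>j<d. A2 i j * s \<sigma> j)" for i \<sigma>
  interpret translation_closed n k2 t
  proof
    fix \<pi> i assume \<pi>: "\<pi> permutes {..<n}" and i: "i < k2"
    \<comment> \<open>A lift of the inverse is taken because the section turns \<open>\<pi>\<close>
      into right translation by \<open>inv \<pi>\<close>.\<close>
    obtain \<kappa> where \<kappa>: "\<kappa> \<in> lifts (inv \<pi>)" using lifts_nonempty[OF permutes_inv[OF \<pi>]] by blast
    then have "\<kappa> permutes {..<d}" "rows_invariant d k2 A2 b2 \<kappa>" by (auto simp: lifts_def)
    then obtain j where j: "j < k2" "b2 j = b2 i"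
        "\<And>y. (\<Sum>l<d. A2 i l * perm_act \<kappa> y l) = (\<Sum>l<d. A2 j l * y l)"
      using row_perm_act i by metis
    have "t j \<sigma> = t i (\<sigma> \<circ> \<pi>)" if "\<sigma> permutes {..<n}" for \<sigma>
      using s(3)[OF that permutes_inv[OF \<pi>] \<kappa>] j(2,3) permutes_inv_inv[OF \<pi>] by (simp add: t_def)
    then show "\<exists>j<k2. \<forall>\<sigma>. \<sigma> permutes {..<n} \<longrightarrow> t j \<sigma> = t i (\<sigma> \<circ> \<pi>)" using j(1) by blast
  qed
  show ?thesis
  proof (rule card_ge_if_separating[OF assms])
    show "0 \<le> t j \<sigma>" if "j < k2" "\<sigma> permutes {..<n}" for j \<sigma>
      using s(1)[OF that(2)] that(1) by (simp add: t_def ef_solutions_def)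
  next
    fix k assume "1 \<le> k" "k < n"
    then show "\<exists>j<k2. (\<forall>\<sigma>. \<sigma> permutes {..<n} \<longrightarrow> \<sigma> ` {..<k} = {..<k} \<longrightarrow> t j \<sigma> = 0) \<and>
        (\<exists>\<sigma>. \<sigma> permutes {..<n} \<and> \<sigma> ` {..<k} = insert k {..<k - 1} \<and> t j \<sigma> \<noteq> 0)"
      using ex_separating_row[OF s(1,2)] unfolding t_def by blast
  qed
qed

end

theorem theorem11:
  fixes n d k1 k2 :: nat
    and P A1 A2 :: "nat \<Rightarrow> nat \<Rightarrow> real"
    and b1 b2 :: "nat \<Rightarrow> real"
  assumes "n \<ge> 6"
    and "is_ext_form_perm n d P k1 A1 b1 k2 A2 b2"
    and "symmetric_ext_form_perm n d P k1 A1 b1 k2 A2 b2"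
  shows "real (d + k1 + k2) \<ge> real n * (real n - 1) / 4"
proof -
  interpret symmetric_formulation n d P k1 A1 b1 k2 A2 b2
    using assms(2,3) by unfold_locales
  have "real (n * (n - 1)) \<le> real (4 * k2)"
    using number_of_inequalities_ge[OF assms(1)] by (simp only: of_nat_le_iff)
  then show ?thesis using assms(1) by (simp add: of_nat_diff)
qed

end
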